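(* If $T\in\mathcal{A}$ and $\mathbf{s},\mathbf{t}\in l^\infty$ with $\mathbf{s}\leqslant\mathbf{t}$, then $\mathbf{s}\cdot T\preccurlyeq\mathbf{t}\cdot T$.
   Context: $\Pi=\mathbb{C}[x]$; $\mathcal{H}_n\subset\Pi$ denotes the set of monic polynomials of degree $n$ all of whose zeros are real ($\mathcal{H}_0=\{1\}$); $\mathcal{Z}(P)$ is the unordered tuple of zeros of $P$ counted with multiplicity. Spectral order: for unordered real $n$-tuples $X,Y$ write $X\prec Y$ if $\sum_{i=1}^n f(x_i)\le\sum_{i=1}^n f(y_i)$ for every convex $f:\mathbb{R}\to\mathbb{R}$ (equivalently, $X=AY$ as column vectors for some doubly stochastic matrix $A$); for $P,Q\in\mathcal{H}_n$ write $Q\preccurlyeq P$ if $\mathcal{Z}(Q)\prec\mathcal{Z}(P)$. The Laguerre-Pólya class $\mathcal{LP}$ is the set of real entire functions of the form $\varphi(x)=cx^me^{-a^2x^2+bx}\prod_{k=1}^\infty(1-\alpha_kx)e^{\alpha_kx}$ with $a,b,c,\alpha_k\in\mathbb{R}$, $c\ne0$, $m$ a nonnegative integer and $\sum_k\alpha_k^2<\infty$. With $D=d/dx$ and $\varphi(x)=\sum_k a_kx^k$, put $\varphi(D)[P]=\sum_k a_kP^{(k)}$ for $P\in\Pi$. $\mathcal{A}$ is the monoid of linear operators $T$ on $\Pi$ with $T(\mathcal{H}_n)\subseteq\mathcal{H}_n$ for all $n\ge0$; by a known theorem of Carnicer, Peña and Pinkus, $\mathcal{A}=\{\varphi(D):\varphi\in\mathcal{LP},\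 \varphi(0)=1\}$. For $T_1,T_2\in\mathcal{A}$ write $T_1\preccurlyeq T_2$ if $T_1[P]\preccurlyeq T_2[P]$ for all $P\in\mathcal{H}_n$ and all $n\ge1$. $l^\infty$ is the space of bounded real sequences $\mathbf{s}=\{s_i\}_{i=0}^\infty$, partially ordered by: $\mathbf{s}\leqslant\mathbf{t}$ iff $|s_i|\le|t_i|$ and $s_it_i\ge0$ for all $i\ge0$. For $\varphi\in\mathcal{LP}$ written as $\varphi(x)=cx^me^{-a^2x^2+bx}\prod_{k=1}^\infty(1-\alpha_kx)e^{\alpha_kx}$ with $a,b,c,\alpha_k\in\mathbb{R}$, $c\ne0$, $m$ a nonnegative integer and $\sum_k\alpha_k^2<\infty$ (with one fixed choice of parameters $a,b,c,(\alpha_k)_{k\ge1}$, used for all deformations of $\varphi$), put $\varphi^{\mathbf{s}}(x)=cx^me^{-s_0^2a^2x^2+bx}\prod_{k=1}^\infty(1-s_k\alpha_kx)e^{s_k\alpha_kx}$. For $T=\varphi(D)\in\mathcal{A}$, $\mathbf{s}\cdot T:=\varphi^{\mathbf{s}}(D)\in\mathcal{A}$. *)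

theory Defs
  imports
    "HOL-Complex_Analysis.Complex_Analysis"
    "HOL-Computational_Algebra.Computational_Algebra"
begin

definition hyperbolic :: "nat \<Rightarrow> complex poly set" where
  "hyperbolic n =
     {P. degree P = n \<and> lead_coeff P = 1 \<and> (\<forall>z. poly P z = 0 \<longrightarrow> z \<in> \<real>)}"

(* Only meaningful for polynomials all of whose zeros are real. *)
definition real_zeros :: "complex poly \<Rightarrow> real multiset" where
  "real_zeros P = image_mset Re (proots P)"

(* Unordered tuples are multisets. *)
definition majorized :: "real multiset \<Rightarrow> real multiset \<Rightarrow> bool" where
  "majorized X Y \<longleftrightarrow> size X = size Y \<and>
     (\<forall>f::real \<Rightarrow> real. convex_on UNIV f \<longrightarrow> (\<Sum>x\<in>#X. f x) \<le> (\<Sum>y\<in>#Y. f y))"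

definition spectral_le :: "complex poly \<Rightarrow> complex poly \<Rightarrow> bool" where
  "spectral_le Q P \<longleftrightarrow>
     (\<exists>n. Q \<in> hyperbolic n \<and> P \<in> hyperbolic n) \<and> majorized (real_zeros Q) (real_zeros P)"

definition preservers :: "(complex poly \<Rightarrow> complex poly) set" where
  "preservers = {T. Vector_Spaces.linear smult smult T \<and> (\<forall>n. T ` hyperbolic n \<subseteq> hyperbolic n)}"

(* An order on preservers: membership of both sides is part of the relation. *)
definition preserver_le ::
  "(complex poly \<Rightarrow> complex poly) \<Rightarrow> (complex poly \<Rightarrow> complex poly) \<Rightarrow> bool" where
  "preserver_le T1 T2 \<longleftrightarrow> T1 \<in> preservers \<and> T2 \<in> preservers \<and>
     (\<forall>n\<ge>1. \<forall>P\<in>hyperbolic n. spectral_le (T1 P) (T2 P))"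

(* The product runs over the indices 1, 2, ...; the value alpha 0 is never used, so that
   index 0 of a deformation sequence is free to act on the Gaussian factor. *)
definition LP_fun ::
  "real \<Rightarrow> real \<Rightarrow> real \<Rightarrow> nat \<Rightarrow> (nat \<Rightarrow> real) \<Rightarrow> complex \<Rightarrow> complex" where
  "LP_fun a b c m \<alpha> z =
     of_real c * z ^ m * exp (- of_real (a\<^sup>2) * z\<^sup>2 + of_real b * z) *
     (\<Prod>k. (1 - of_real (\<alpha> (Suc k)) * z) * exp (of_real (\<alpha> (Suc k)) * z))"

(* The Laguerre-Polya class is the set of all LP_fun a b c m alpha with LP_params a b c m alpha. *)
definition LP_params :: "real \<Rightarrow> real \<Rightarrow> real \<Rightarrow> nat \<Rightarrow> (nat \<Rightarrow> real) \<Rightarrow> bool" where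
  "LP_params a b c m \<alpha> \<longleftrightarrow> c \<noteq> 0 \<and> summable (\<lambda>k. (\<alpha> (Suc k))\<^sup>2)"

(* The deformation depends on the parameters, not only on the function LP_fun a b c m alpha. *)
definition LP_deform ::
  "(nat \<Rightarrow> real) \<Rightarrow> real \<Rightarrow> real \<Rightarrow> real \<Rightarrow> nat \<Rightarrow> (nat \<Rightarrow> real) \<Rightarrow> complex \<Rightarrow> complex" where
  "LP_deform s a b c m \<alpha> = LP_fun (s 0 * a) b c m (\<lambda>k. s k * \<alpha> k)"

(* Terms of order above degree P vanish, so the finite sum is the whole series. *)
definition diff_op :: "(complex \<Rightarrow> complex) \<Rightarrow> complex poly \<Rightarrow> complex poly" where
  "diff_op \<phi> P = (\<Sum>k\<le>degree P. smult ((deriv ^^ k) \<phi> 0 / fact k) ((pderiv ^^ k) P))"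

definition l_infinity :: "(nat \<Rightarrow> real) set" where
  "l_infinity = {s. bounded (range s)}"

definition seq_le :: "(nat \<Rightarrow> real) \<Rightarrow> (nat \<Rightarrow> real) \<Rightarrow> bool" where
  "seq_le s t \<longleftrightarrow> (\<forall>i. \<bar>s i\<bar> \<le> \<bar>t i\<bar> \<and> s i * t i \<ge> 0)"

end

theory Submission
  imports Defs
begin

text \<open>
  Since \<open>exp (- a\<^sup>2 z\<^sup>2)\<close> is the limit of \<open>((1 - a z / \<surd>N) (1 + a z / \<surd>N))\<^sup>N\<close>, both operators are limits
  of finite products of a shift and commuting factors \<open>(1 - \<alpha> D) exp (\<alpha> D)\<close>, and the spectral order
  passes to limits, so it suffices to deform a single factor acting on a hyperbolic polynomial \<open>P\<close>
  with simple zeros \<open>x\<close>. The zeros of \<open>(1 - \<alpha> D) exp (\<alpha> D) P\<close> are the eigenvalues of the symmetric matrix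
  with diagonal \<open>x\<close> and all off-diagonal entries \<open>\<alpha>\<close>, as this is a rank-one perturbation of a
  diagonal matrix. For \<open>0 \<le> \<theta> \<le> 1\<close> the matrix for \<open>\<theta> \<beta>\<close> is a convex combination of the one for \<open>\<beta>\<close>
  and of its diagonal; Jensen's inequality in an eigenbasis then compares the sums of a convex
  function over the spectra.
\<close>

section \<open>Trace inequalities for a rank-one perturbation\<close>

definition onb :: "'a set \<Rightarrow> 'b set \<Rightarrow> ('a \<Rightarrow> 'b \<Rightarrow> real) \<Rightarrow> bool" where
  "onb A X u \<longleftrightarrow> finite A \<and> finite X \<and> card A = card X \<and>
     (\<forall>a\<in>A. \<forall>a'\<in>A. (\<Sum>x\<in>X. u a x * u a' x) = (if a = a' then 1 else 0))"

text \<open>The orthogonal projection onto the span of the rows has trace \<open>card A = card X\<close>, so the squared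
  distances of the standard basis vectors from this span add up to 0.\<close>

lemma onb_columns:
  assumes "onb A X u" "x \<in> X" "x' \<in> X"
  shows "(\<Sum>a\<in>A. u a x * u a x') = (if x = x' then 1 else 0)"
proof -
  have fin: "finite A" "finite X" and card: "card A = card X"
    and rows: "\<And>a a'. a \<in> A \<Longrightarrow> a' \<in> A \<Longrightarrow> (\<Sum>x\<in>X. u a x * u a' x) = (if a = a' then 1 else 0)"
    using assms(1) by (auto simp: onb_def)
  define \<delta> :: "'b \<Rightarrow> 'b \<Rightarrow> real" where "\<delta> x y = (if x = y then 1 else 0)" for x y
  define p where "p x y = (\<Sum>a\<in>A. u a x * u a y)" for x y
  \<comment> \<open>\<open>p\<close> is the matrix of the projection. It is symmetric and
    idempotent, so the squared norm of its row at \<open>x\<close> is the diagonal entry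
    there.\<close>
  have pp: "(\<Sum>y\<in>X. (p x y)\<^sup>2) = p x x" for x
  proof -
    have "(\<Sum>y\<in>X. (p x y)\<^sup>2) = (\<Sum>y\<in>X. \<Sum>a\<in>A. \<Sum>a'\<in>A. u a x * u a' x * (u a y * u a' y))"
      by (simp add: p_def power2_eq_square sum_product mult_ac)
    also have "\<dots> = (\<Sum>a\<in>A. \<Sum>a'\<in>A. \<Sum>y\<in>X. u a x * u a' x * (u a y * u a' y))"
      by (subst sum.swap, intro sum.cong refl, rule sum.swap)
    also have "\<dots> = (\<Sum>a\<in>A. \<Sum>a'\<in>A. u a x * u a' x * (if a = a' then 1 else 0))"
      by (simp add: sum_distrib_left[symmetric] rows)
    also have "\<dots> = p x x"
      using fin by (simp add: p_def if_distrib[of "\<lambda>t. _ * t"] cong: if_cong)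
    finally show ?thesis .
  qed
  have defect: "(\<Sum>y\<in>X. (\<delta> x y - p x y)\<^sup>2) = 1 - p x x" if "x \<in> X" for x
  proof -
    have "(\<Sum>y\<in>X. (\<delta> x y - p x y)\<^sup>2) = (\<Sum>y\<in>X. (p x y)\<^sup>2 + (if x = y then 1 - 2 * p x x else 0))"
      by (intro sum.cong refl) (auto simp: \<delta>_def power2_diff)
    also have "\<dots> = 1 - p x x"
      using fin that by (simp add: sum.distrib pp)
    finally show ?thesis .
  qed
  have "(\<Sum>x\<in>X. p x x) = (\<Sum>a\<in>A. \<Sum>x\<in>X. u a x * u a x)"
    unfolding p_def by (rule sum.swap)
  also have "\<dots> = card X"
    by (simp add: rows card)
  finally have "(\<Sum>x\<in>X. \<Sum>y\<in>X. (\<delta> x y - p x y)\<^sup>2) = 0"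
    by (simp add: defect sum_subtractf)
  then have "(\<Sum>y\<in>X. (\<delta> x y - p x y)\<^sup>2) = 0"
    using assms(2) fin by (subst (asm) sum_nonneg_eq_0_iff) (auto intro: sum_nonneg)
  then have "(\<delta> x x' - p x x')\<^sup>2 = 0"
    using assms(3) fin by (subst (asm) sum_nonneg_eq_0_iff) auto
  then show ?thesis
    by (simp add: \<delta>_def p_def)
qed

lemma onb_std: "finite X \<Longrightarrow> onb X X (\<lambda>a x. of_bool (a = x))"
  by (auto simp: onb_def of_bool_def if_distrib[of "\<lambda>t. t * _"] sum.delta cong: if_cong)

text \<open>Jensen's inequality for the doubly stochastic matrix of squared inner products of two
  orthonormal bases.\<close>

lemma peierls_inequality:
  assumes u: "onb A X u" and v: "onb B X v"
    and eig: "\<And>b x. b \<in> B \<Longrightarrow> x \<in> X \<Longrightarrow> (\<Sum>x'\<in>X. M x x' * v b x') = \<mu> b * v b x"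
    and f: "convex_on UNIV f"
  shows "(\<Sum>a\<in>A. f (\<Sum>x\<in>X. \<Sum>x'\<in>X. u a x * M x x' * u a x')) \<le> (\<Sum>b\<in>B. f (\<mu> b))"
proof -
  have fin: "finite A" "finite X" "finite B"
    using u v by (auto simp: onb_def)
  define c where "c a b = (\<Sum>x\<in>X. u a x * v b x)" for a b
  have expand: "(\<Sum>b\<in>B. c a b * v b x) = u a x" if "x \<in> X" for a x
  proof -
    have "(\<Sum>b\<in>B. c a b * v b x) = (\<Sum>x'\<in>X. u a x' * (\<Sum>b\<in>B. v b x' * v b x))"
      unfolding c_def sum_distrib_left sum_distrib_right by (subst sum.swap) (simp add: mult_ac)
    also have "\<dots> = (\<Sum>x'\<in>X. u a x' * (if x' = x then 1 else 0))"
      using that by (intro sum.cong refl) (simp add: onb_columns[OF v])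
    finally show ?thesis
      using that fin by (simp add: if_distrib[of "\<lambda>t. _ * t"] cong: if_cong)
  qed
  have expand': "(\<Sum>a\<in>A. c a b * u a x) = v b x" if "x \<in> X" for b x
  proof -
    have "(\<Sum>a\<in>A. c a b * u a x) = (\<Sum>x'\<in>X. v b x' * (\<Sum>a\<in>A. u a x' * u a x))"
      unfolding c_def sum_distrib_left sum_distrib_right by (subst sum.swap) (simp add: mult_ac)
    also have "\<dots> = (\<Sum>x'\<in>X. v b x' * (if x' = x then 1 else 0))"
      using that by (intro sum.cong refl) (simp add: onb_columns[OF u])
    finally show ?thesis
      using that fin by (simp add: if_distrib[of "\<lambda>t. _ * t"] cong: if_cong)
  qed
  \<comment> \<open>By Parseval in either basis the squares of \<open>c\<close> have row and column
    sums 1: the rows supply the weights for Jensen, the columns restore the plain sum over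
    \<open>B\<close>.\<close>
  have row: "(\<Sum>b\<in>B. (c a b)\<^sup>2) = 1" if "a \<in> A" for a
  proof -
    have "(\<Sum>b\<in>B. (c a b)\<^sup>2) = (\<Sum>b\<in>B. \<Sum>x\<in>X. u a x * (c a b * v b x))"
      by (simp add: c_def power2_eq_square sum_distrib_left sum_distrib_right mult_ac)
    also have "\<dots> = (\<Sum>x\<in>X. u a x * (\<Sum>b\<in>B. c a b * v b x))"
      by (subst sum.swap) (simp add: sum_distrib_left)
    also have "\<dots> = 1"
      using u that by (simp add: expand onb_def)
    finally show ?thesis .
  qed
  have col: "(\<Sum>a\<in>A. (c a b)\<^sup>2) = 1" if "b \<in> B" for b
  proof -
    have "(\<Sum>a\<in>A. (c a b)\<^sup>2) = (\<Sum>a\<in>A. \<Sum>x\<in>X. v b x * (c a b * u a x))"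
      by (simp add: c_def power2_eq_square sum_distrib_left sum_distrib_right mult_ac)
    also have "\<dots> = (\<Sum>x\<in>X. v b x * (\<Sum>a\<in>A. c a b * u a x))"
      by (subst sum.swap) (simp add: sum_distrib_left)
    also have "\<dots> = 1"
      using v that by (simp add: expand' onb_def)
    finally show ?thesis .
  qed
  have quad: "(\<Sum>x\<in>X. \<Sum>x'\<in>X. u a x * M x x' * u a x') = (\<Sum>b\<in>B. (c a b)\<^sup>2 * \<mu> b)" for a
  proof -
    have "(\<Sum>x\<in>X. \<Sum>x'\<in>X. u a x * M x x' * u a x') =
        (\<Sum>x\<in>X. \<Sum>x'\<in>X. \<Sum>b\<in>B. u a x * c a b * (M x x' * v b x'))"
    proof (intro sum.cong refl)
      fix x x' assume x': "x' \<in> X"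
      have "u a x * M x x' * u a x' = u a x * M x x' * (\<Sum>b\<in>B. c a b * v b x')"
        by (simp only: expand[OF x'])
      then show "u a x * M x x' * u a x' = (\<Sum>b\<in>B. u a x * c a b * (M x x' * v b x'))"
        by (simp add: sum_distrib_left mult_ac)
    qed
    also have "\<dots> = (\<Sum>x\<in>X. \<Sum>b\<in>B. u a x * c a b * (\<Sum>x'\<in>X. M x x' * v b x'))"
      by (intro sum.cong refl, subst sum.swap) (simp add: sum_distrib_left)
    also have "\<dots> = (\<Sum>x\<in>X. \<Sum>b\<in>B. c a b * \<mu> b * (u a x * v b x))"
      by (intro sum.cong refl) (simp add: eig)
    also have "\<dots> = (\<Sum>b\<in>B. (c a b)\<^sup>2 * \<mu> b)"
      by (subst sum.swap) (simp add: sum_distrib_left[symmetric] power2_eq_square mult_ac c_def[symmetric])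
    finally show ?thesis .
  qed
  have "(\<Sum>a\<in>A. f (\<Sum>x\<in>X. \<Sum>x'\<in>X. u a x * M x x' * u a x')) \<le> (\<Sum>a\<in>A. \<Sum>b\<in>B. (c a b)\<^sup>2 * f (\<mu> b))"
  proof (rule sum_mono)
    fix a assume a: "a \<in> A"
    then have "B \<noteq> {}" using row[OF a] by auto
    then show "f (\<Sum>x\<in>X. \<Sum>x'\<in>X. u a x * M x x' * u a x') \<le> (\<Sum>b\<in>B. (c a b)\<^sup>2 * f (\<mu> b))"
      using convex_on_sum[OF fin(3) _ f row[OF a], of \<mu>] by (simp add: quad)
  qed
  also have "\<dots> = (\<Sum>b\<in>B. (\<Sum>a\<in>A. (c a b)\<^sup>2) * f (\<mu> b))"
    by (subst sum.swap) (simp add: sum_distrib_right)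
  also have "\<dots> = (\<Sum>b\<in>B. f (\<mu> b))" by (simp add: col)
  finally show ?thesis .
qed


text \<open>For P the monic polynomial with simple zeros \<open>X\<close>, the sum is P'/P at y, so
  these are the zeros of P - \<alpha> P' outside \<open>X\<close>.\<close>

definition secular_roots :: "real set \<Rightarrow> real \<Rightarrow> real set" where
  "secular_roots X \<alpha> = {y. y \<notin> X \<and> \<alpha> * (\<Sum>x\<in>X. 1 / (y - x)) = 1}"

text \<open>At a secular root y this is a unit eigenvector of D + \<alpha> J, with D the diagonal
  matrix of \<open>X\<close> and J the all-ones matrix: up to scaling, it is the inverse of y - D
  applied to the all-ones vector.\<close>

definition secular_vec :: "real set \<Rightarrow> real \<Rightarrow> real \<Rightarrow> real" where
  "secular_vec X y x = 1 / (y - x) / sqrt (\<Sum>x\<in>X. (1 / (y - x))\<^sup>2)"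

text \<open>This is D - \<alpha> I + \<alpha> J. Subtracting \<alpha> keeps the diagonal independent
  of \<alpha>; it corresponds to the shift by the exponential in a factor.\<close>

definition offdiag :: "real \<Rightarrow> real \<Rightarrow> real \<Rightarrow> real" where
  "offdiag \<alpha> x x' = (if x = x' then x else \<alpha>)"

lemma secular_sum_squares_pos:
  assumes "finite X" "y \<in> secular_roots X \<alpha>"
  shows "(\<Sum>x\<in>X. (1 / (y - x))\<^sup>2) > 0"
proof -
  have "X \<noteq> {}" using assms by (auto simp: secular_roots_def)
  moreover have "(1 / (y - x))\<^sup>2 > 0" if "x \<in> X" for x
    using assms that by (auto simp: secular_roots_def)
  ultimately show ?thesis using assms(1) by (intro sum_pos) auto
qed

text \<open>Partial fractions turn the inner product for distinct roots into a multiple of the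
  difference of two secular sums, both equal to 1 / \<alpha>. The cardinality assumption makes the
  orthonormal family a basis; \<open>sub_pderiv_distinct\<close> supplies it later.\<close>

lemma secular_onb:
  assumes "finite X" and card: "card (secular_roots X \<alpha>) = card X"
  shows "onb (secular_roots X \<alpha>) X (secular_vec X)"
proof -
  \<comment> \<open>An infinite set has cardinality 0, which settles nonempty \<open>X\<close>; for
    empty \<open>X\<close> the secular equation reads 0 = 1.\<close>
  have "finite (secular_roots X \<alpha>)"
    using assms by (cases "X = {}") (auto simp: secular_roots_def intro: card_ge_0_finite)
  moreover have "(\<Sum>x\<in>X. secular_vec X y x * secular_vec X z x) = (if y = z then 1 else 0)"
    if y: "y \<in> secular_roots X \<alpha>" and z: "z \<in> secular_roots X \<alpha>" for y z
  proof (cases "y = z")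
    case True
    let ?S = "\<Sum>x\<in>X. (1 / (y - x))\<^sup>2"
    have pos: "?S > 0" by (rule secular_sum_squares_pos[OF assms(1) y])
    then have "(a / sqrt ?S) * (a / sqrt ?S) = a\<^sup>2 / ?S" for a
      by (simp add: power2_eq_square)
    then have "(\<Sum>x\<in>X. secular_vec X y x * secular_vec X z x) = (\<Sum>x\<in>X. (1 / (y - x))\<^sup>2 / ?S)"
      unfolding secular_vec_def True[symmetric] by (intro sum.cong refl)
    also have "\<dots> = 1" using pos by (simp add: sum_divide_distrib[symmetric])
    finally show ?thesis using True by simp
  next
    case False
    let ?c = "sqrt (\<Sum>x\<in>X. (1 / (y - x))\<^sup>2)" and ?d = "sqrt (\<Sum>x\<in>X. (1 / (z - x))\<^sup>2)"
    have "(\<Sum>x\<in>X. secular_vec X y x * secular_vec X z x) =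
        (\<Sum>x\<in>X. (1 / (y - x) - 1 / (z - x)) / ((z - y) * ?c * ?d))"
    proof (rule sum.cong[OF refl])
      fix x assume "x \<in> X"
      then have "y - x \<noteq> 0" "z - x \<noteq> 0" using y z by (auto simp: secular_roots_def)
      moreover have "?c \<noteq> 0" "?d \<noteq> 0" 
        using secular_sum_squares_pos[OF assms(1)] y z by force+
      ultimately show "secular_vec X y x * secular_vec X z x =
          (1 / (y - x) - 1 / (z - x)) / ((z - y) * ?c * ?d)"
        using False unfolding secular_vec_def by (simp add: divide_simps)
    qed
    also have "\<dots> = ((\<Sum>x\<in>X. 1 / (y - x)) - (\<Sum>x\<in>X. 1 / (z - x))) / ((z - y) * ?c * ?d)"
      by (simp add: sum_subtractf[symmetric] sum_divide_distrib)
    also have "(\<Sum>x\<in>X. 1 / (y - x)) = (\<Sum>x\<in>X. 1 / (z - x))"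
      using y z by (auto simp: secular_roots_def) (metis mult_cancel_left mult_zero_left zero_neq_one)
    finally show ?thesis using False by simp
  qed
  ultimately show ?thesis using assms by (auto simp: onb_def)
qed

text \<open>By the secular equation, \<alpha> J sends the vector to the constant 1 /
  \<open>?c\<close>, which is (y - x) times its entry at x. Adding the diagonal part x - \<alpha>
  leaves the factor y - \<alpha>.\<close>

lemma secular_eigen:
  assumes "finite X" "y \<in> secular_roots X \<alpha>" "x \<in> X"
  shows "(\<Sum>x'\<in>X. offdiag \<alpha> x x' * secular_vec X y x') = (y - \<alpha>) * secular_vec X y x"
proof -
  let ?c = "sqrt (\<Sum>x\<in>X. (1 / (y - x))\<^sup>2)"
  have ne: "y - x \<noteq> 0" "?c \<noteq> 0"
    using assms secular_sum_squares_pos[OF assms(1,2)] by (auto simp: secular_roots_def)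
  have "(\<Sum>x'\<in>X. offdiag \<alpha> x x' * secular_vec X y x') =
      (\<Sum>x'\<in>X. (if x = x' then (x - \<alpha>) * secular_vec X y x else 0) + \<alpha> * (1 / (y - x')) / ?c)"
  proof (intro sum.cong refl)
    fix x' :: real
    have "\<alpha> * (1 / (y - x')) / ?c = \<alpha> * secular_vec X y x'"
      by (simp add: secular_vec_def)
    then show "offdiag \<alpha> x x' * secular_vec X y x' =
        (if x = x' then (x - \<alpha>) * secular_vec X y x else 0) + \<alpha> * (1 / (y - x')) / ?c"
      by (auto simp: offdiag_def algebra_simps)
  qed
  also have "\<dots> = (x - \<alpha>) * secular_vec X y x + \<alpha> * (\<Sum>x'\<in>X. 1 / (y - x')) / ?c"
    using assms by (simp add: sum.distrib sum_divide_distrib sum_distrib_left)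
  also have "\<alpha> * (\<Sum>x'\<in>X. 1 / (y - x')) = 1"
    using assms by (simp add: secular_roots_def)
  also have "(x - \<alpha>) * secular_vec X y x + 1 / ?c = (y - \<alpha>) * secular_vec X y x"
    using ne unfolding secular_vec_def by (simp add: divide_simps)
  finally show ?thesis .
qed

lemma quadratic_form_std:
  assumes "finite X" "a \<in> X"
  shows "(\<Sum>x\<in>X. \<Sum>x'\<in>X. of_bool (a = x) * M x x' * of_bool (a = x')) = (M a a :: real)"
proof -
  have "(\<Sum>x\<in>X. \<Sum>x'\<in>X. of_bool (a = x) * M x x' * of_bool (a = x')) =
      (\<Sum>x\<in>X. if a = x then M a a else 0)"
    using assms by (intro sum.cong refl) (auto simp: of_bool_def if_distrib[of "\<lambda>t. _ * t"] cong: if_cong)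
  then show ?thesis using assms by simp
qed

text \<open>Schur's inequality: in the standard basis the quadratic form takes the diagonal entries,
  here the points of \<open>X\<close>, as values, and these are compared with the spectrum.\<close>

lemma secular_trace_ge:
  assumes "finite X" "card (secular_roots X \<beta>) = card X" "convex_on UNIV f"
  shows "(\<Sum>x\<in>X. f x) \<le> (\<Sum>y\<in>secular_roots X \<beta>. f (y - \<beta>))"
proof -
  have "(\<Sum>x\<in>X. f x) = (\<Sum>a\<in>X. f (\<Sum>x\<in>X. \<Sum>x'\<in>X. of_bool (a = x) * offdiag \<beta> x x' * of_bool (a = x')))"
    by (intro sum.cong refl, subst quadratic_form_std[OF assms(1)]) (simp_all add: offdiag_def)
  also have "\<dots> \<le> (\<Sum>y\<in>secular_roots X \<beta>. f (y - \<beta>))"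
    by (rule peierls_inequality[OF onb_std secular_onb]) (use assms in \<open>auto simp: secular_eigen\<close>)
  finally show ?thesis .
qed

text \<open>Writing \<open>offdiag \<alpha>\<close> as a convex combination of \<open>offdiag 0\<close>, which is diagonal, and
  \<open>offdiag \<beta>\<close>, evaluate both in the eigenbasis of \<open>offdiag \<alpha>\<close>.\<close>

lemma secular_trace_mono:
  assumes X: "finite X" and f: "convex_on UNIV f" and \<theta>: "0 \<le> \<theta>" "\<theta> \<le> 1"
    and \<alpha>: "card (secular_roots X (\<theta> * \<beta>)) = card X" and \<beta>: "card (secular_roots X \<beta>) = card X"
  shows "(\<Sum>y\<in>secular_roots X (\<theta> * \<beta>). f (y - \<theta> * \<beta>)) \<le> (\<Sum>y\<in>secular_roots X \<beta>. f (y - \<beta>))"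
proof -
  let ?Y = "secular_roots X (\<theta> * \<beta>)" and ?u = "secular_vec X"
  define q where "q c y = (\<Sum>x\<in>X. \<Sum>x'\<in>X. ?u y x * offdiag c x x' * ?u y x')" for c y
  have onb: "onb ?Y X ?u" by (rule secular_onb[OF X \<alpha>])
  have q_eig: "q (\<theta> * \<beta>) y = y - \<theta> * \<beta>" if y: "y \<in> ?Y" for y
  proof -
    have "q (\<theta> * \<beta>) y = (\<Sum>x\<in>X. ?u y x * (\<Sum>x'\<in>X. offdiag (\<theta> * \<beta>) x x' * ?u y x'))"
      by (simp add: q_def sum_distrib_left mult_ac)
    also have "\<dots> = (\<Sum>x\<in>X. (y - \<theta> * \<beta>) * (?u y x * ?u y x))"
      by (intro sum.cong refl) (simp add: secular_eigen[OF X y])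
    also have "\<dots> = y - \<theta> * \<beta>"
      using onb y by (simp add: sum_distrib_left[symmetric] onb_def)
    finally show ?thesis .
  qed
  have q_conv: "q (\<theta> * \<beta>) y = (1 - \<theta>) * q 0 y + \<theta> * q \<beta> y" for y
  proof -
    have offdiag: "offdiag (\<theta> * \<beta>) x x' = (1 - \<theta>) * offdiag 0 x x' + \<theta> * offdiag \<beta> x x'" for x x'
      by (simp add: offdiag_def algebra_simps)
    show ?thesis
      unfolding q_def offdiag sum_distrib_left sum.distrib[symmetric]
      by (intro sum.cong refl) (simp add: algebra_simps)
  qed
  have "(\<Sum>y\<in>?Y. f (y - \<theta> * \<beta>)) = (\<Sum>y\<in>?Y. f ((1 - \<theta>) * q 0 y + \<theta> * q \<beta> y))"
    by (intro sum.cong refl) (simp add: q_eig q_conv[symmetric])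
  also have "\<dots> \<le> (\<Sum>y\<in>?Y. (1 - \<theta>) * f (q 0 y) + \<theta> * f (q \<beta> y))"
    using convex_onD[OF f \<theta>(1) \<theta>(2)] by (intro sum_mono) simp
  also have "\<dots> = (1 - \<theta>) * (\<Sum>y\<in>?Y. f (q 0 y)) + \<theta> * (\<Sum>y\<in>?Y. f (q \<beta> y))"
    by (simp add: sum.distrib sum_distrib_left)
  also have "\<dots> \<le> (1 - \<theta>) * (\<Sum>y\<in>secular_roots X \<beta>. f (y - \<beta>)) +
      \<theta> * (\<Sum>y\<in>secular_roots X \<beta>. f (y - \<beta>))"
  proof (intro add_mono mult_left_mono)
    \<comment> \<open>The standard basis diagonalizes \<open>offdiag 0\<close>, whose spectrum is
      \<open>X\<close>; the passage from \<open>X\<close> to the spectrum for \<beta> is then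
      Schur's inequality. Both summands thus share one bound, and their weights add up to 1.\<close>
    have "(\<Sum>y\<in>?Y. f (q 0 y)) \<le> (\<Sum>x\<in>X. f x)"
      unfolding q_def
    proof (rule peierls_inequality[OF onb onb_std[OF X] _ f])
      fix b x assume "b \<in> X" "x \<in> X"
      then show "(\<Sum>x'\<in>X. offdiag 0 x x' * of_bool (b = x')) = b * of_bool (b = x)"
        using X by (auto simp: offdiag_def of_bool_def if_distrib[of "\<lambda>t. _ * t"] cong: if_cong)
    qed
    also have "\<dots> \<le> (\<Sum>y\<in>secular_roots X \<beta>. f (y - \<beta>))"
      by (rule secular_trace_ge[OF X \<beta> f])
    finally show "(\<Sum>y\<in>?Y. f (q 0 y)) \<le> (\<Sum>y\<in>secular_roots X \<beta>. f (y - \<beta>))" .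
    show "(\<Sum>y\<in>?Y. f (q \<beta> y)) \<le> (\<Sum>y\<in>secular_roots X \<beta>. f (y - \<beta>))"
      unfolding q_def
      by (rule peierls_inequality[OF onb secular_onb[OF X \<beta>] _ f]) (simp add: secular_eigen[OF X])
  qed (use \<theta> in auto)
  finally show ?thesis by (simp add: algebra_simps)
qed

section \<open>Differential operators given by power series\<close>

text \<open>Formal series replace functions here so that composition of operators becomes
  multiplication in a commutative ring, with no question of convergence.\<close>

definition diff_fps :: "complex fps \<Rightarrow> complex poly \<Rightarrow> complex poly" where
  "diff_fps F P = (\<Sum>k\<le>degree P. smult (fps_nth F k) ((pderiv ^^ k) P))"

lemma higher_pderiv_eq_0:
  fixes p :: "'a :: {comm_semiring_1, semiring_no_zero_divisors, semiring_char_0} poly"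
  shows "degree p < k \<Longrightarrow> (pderiv ^^ k) p = 0"
  by (rule poly_eqI) (simp add: coeff_higher_pderiv coeff_eq_0)

lemma smult_sum_right: "smult c (\<Sum>i\<in>A. f i) = (\<Sum>i\<in>A. smult c (f i))"
  by (induction A rule: infinite_finite_induct) (simp_all add: smult_add_right)

text \<open>Raising the upper summation bound lets polynomials of different degrees be treated with
  one common range.\<close>

lemma diff_fps_eq:
  assumes "degree P \<le> N"
  shows "diff_fps F P = (\<Sum>k\<le>N. smult (fps_nth F k) ((pderiv ^^ k) P))"
  unfolding diff_fps_def using assms
  by (intro sum.mono_neutral_left) (auto simp: higher_pderiv_eq_0)

lemma poly_diff_fps: "poly (diff_fps F P) z = (\<Sum>k\<le>degree P. fps_nth F k * poly ((pderiv ^^ k) P) z)"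
  by (simp add: diff_fps_def poly_sum)

lemma diff_fps_add: "diff_fps F (P + Q) = diff_fps F P + diff_fps F Q"
  by (simp add: diff_fps_eq[where N = "max (degree P) (degree Q)"] degree_add_le_max
      higher_pderiv_add smult_add_right sum.distrib)

lemma diff_fps_smult: "diff_fps F (smult c P) = smult c (diff_fps F P)"
  by (simp add: diff_fps_eq[where N = "degree P"] degree_smult_le higher_pderiv_smult smult_sum_right mult_ac)

lemma linear_diff_fps: "Vector_Spaces.linear smult smult (diff_fps F)"
  by unfold_locales (simp_all add: diff_fps_add diff_fps_smult smult_add_right smult_add_left)

lemma diff_fps_fps_add: "diff_fps (F + G) P = diff_fps F P + diff_fps G P"
  by (simp add: diff_fps_def smult_add_left sum.distrib)

lemma diff_fps_fps_const_mult: "diff_fps (fps_const c * F) P = smult c (diff_fps F P)"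
  by (simp add: diff_fps_def smult_sum_right)

lemma diff_fps_1: "diff_fps 1 P = P"
proof -
  have "diff_fps 1 P = (\<Sum>k\<le>degree P. if k = 0 then P else 0)"
    unfolding diff_fps_def by (intro sum.cong) auto
  then show ?thesis by simp
qed

lemma diff_fps_X: "diff_fps fps_X P = pderiv P"
proof -
  have "diff_fps fps_X P = (\<Sum>k\<le>Suc (degree P). if k = 1 then pderiv P else 0)"
    unfolding diff_fps_eq[OF le_SucI[OF order_refl]] by (intro sum.cong) (auto simp: fps_X_def)
  then show ?thesis by (simp del: sum.atMost_Suc)
qed

lemma degree_diff_fps_le: "degree (diff_fps F P) \<le> degree P"
  unfolding diff_fps_def
  by (intro degree_sum_le) (auto intro: order_trans[OF degree_smult_le] simp: degree_higher_pderiv)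

lemma diff_fps_mult: "diff_fps (F * G) P = diff_fps F (diff_fps G P)"
proof -
  let ?N = "degree P"
  define t where "t i j = smult (fps_nth F i * fps_nth G j) ((pderiv ^^ (i + j)) P)" for i j
  have "diff_fps F (diff_fps G P) = (\<Sum>i\<le>?N. smult (fps_nth F i) ((pderiv ^^ i) (diff_fps G P)))"
    by (rule diff_fps_eq[OF degree_diff_fps_le])
  also have "\<dots> = (\<Sum>i\<le>?N. \<Sum>j\<le>?N. t i j)"
    by (simp add: t_def diff_fps_def higher_pderiv_sum higher_pderiv_smult smult_sum_right funpow_add)
  also have "\<dots> = (\<Sum>(i, j)\<in>{..?N} \<times> {..?N}. t i j)"
    by (rule sum.cartesian_product)
  \<comment> \<open>Derivatives of order above the degree vanish, so the square shrinks to the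
    triangle on which the Cauchy product lives.\<close>
  also have "\<dots> = (\<Sum>(i, j)\<in>{(i, j). i + j \<le> ?N}. t i j)"
    by (intro sum.mono_neutral_right) (auto simp: t_def, metis higher_pderiv_eq_0 not_le)
  also have "\<dots> = (\<Sum>k\<le>?N. \<Sum>i\<le>k. t i (k - i))"
    by (rule sum.triangle_reindex_eq)
  also have "\<dots> = diff_fps (F * G) P"
    by (simp add: t_def diff_fps_def fps_mult_nth atLeast0AtMost smult_sum)
  finally show ?thesis by simp
qed

text \<open>Leibniz rule for the product of x and p. At k = 0 the truncated \<open>k - 1\<close> is
  harmless, since its coefficient is 0.\<close>

lemma higher_pderiv_pCons_0:
  "(pderiv ^^ k) (pCons 0 p) = pCons 0 ((pderiv ^^ k) p) + smult (of_nat k) ((pderiv ^^ (k - 1)) p)"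
proof (induction k)
  case (Suc k)
  then show ?case
    by (cases k) (simp_all add: pderiv_add pderiv_smult pderiv_pCons smult_add_left algebra_simps)
qed simp

lemma sum_pCons_0: "(\<Sum>k\<in>A. pCons 0 (f k)) = pCons 0 (sum f A)"
  by (induction A rule: infinite_finite_induct) auto

text \<open>The commutator of F(D) with multiplication by x is F'(D). This gives a recursion over
  the coefficients of a polynomial.\<close>

lemma diff_fps_pCons:
  "diff_fps F (pCons a p) = [:a * fps_nth F 0:] + pCons 0 (diff_fps F p) + diff_fps (fps_deriv F) p"
proof -
  let ?N = "degree p"
  have "diff_fps F (pCons 0 p) = (\<Sum>k\<le>Suc ?N. smult (fps_nth F k) ((pderiv ^^ k) (pCons 0 p)))"
    by (rule diff_fps_eq) (simp add: degree_pCons_le)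
  also have "\<dots> = (\<Sum>k\<le>Suc ?N. pCons 0 (smult (fps_nth F k) ((pderiv ^^ k) p))) +
      (\<Sum>k\<le>Suc ?N. smult (of_nat k * fps_nth F k) ((pderiv ^^ (k - 1)) p))"
    unfolding sum.distrib[symmetric]
    by (intro sum.cong refl) (simp add: higher_pderiv_pCons_0 smult_add_right mult_ac)
  also have "(\<Sum>k\<le>Suc ?N. pCons 0 (smult (fps_nth F k) ((pderiv ^^ k) p))) = pCons 0 (diff_fps F p)"
    by (simp only: sum_pCons_0 diff_fps_eq[where N = "Suc ?N" and P = p, OF le_SucI[OF order_refl]])
  also have "(\<Sum>k\<le>Suc ?N. smult (of_nat k * fps_nth F k) ((pderiv ^^ (k - 1)) p)) =
      diff_fps (fps_deriv F) p"
    unfolding sum.atMost_Suc_shift by (simp add: diff_fps_def del: of_nat_Suc)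
  finally have "diff_fps F (pCons 0 p) = pCons 0 (diff_fps F p) + diff_fps (fps_deriv F) p" .
  moreover have "diff_fps F [:a:] = [:a * fps_nth F 0:]"
    by (simp add: diff_fps_def mult.commute)
  moreover have "pCons a p = [:a:] + pCons 0 p" by simp
  ultimately show ?thesis by (metis diff_fps_add add.assoc)
qed

text \<open>Taylor's formula. The exponential series is reproduced by differentiation up to the
  factor c, so the recursion of \<open>diff_fps_pCons\<close> becomes that of
  \<open>pcompose\<close>.\<close>

lemma diff_fps_exp: "diff_fps (fps_exp c) P = pcompose P [:c, 1:]"
proof (induction P)
  case 0
  show ?case by (simp add: diff_fps_def)
next
  case (pCons a p)
  then show ?case
    by (simp add: diff_fps_pCons diff_fps_fps_const_mult pcompose_pCons algebra_simps)
qed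

definition lp_factor :: "real \<Rightarrow> complex fps" where
  "lp_factor \<alpha> = fps_exp (of_real \<alpha>) * (1 - fps_const (of_real \<alpha>) * fps_X)"

lemma diff_fps_lp_factor:
  "diff_fps (lp_factor \<alpha>) P = pcompose (P - smult (of_real \<alpha>) (pderiv P)) [:of_real \<alpha>, 1:]"
proof -
  have "diff_fps (1 - fps_const (of_real \<alpha>) * fps_X) P =
      diff_fps (1 + fps_const (- of_real \<alpha>) * fps_X) P"
    by (simp add: fps_const_neg[symmetric] del: fps_const_neg)
  also have "\<dots> = P - smult (of_real \<alpha>) (pderiv P)"
    by (simp only: diff_fps_fps_add diff_fps_fps_const_mult diff_fps_1 diff_fps_X smult_minus_left) simp
  finally show ?thesis by (simp add: lp_factor_def diff_fps_mult diff_fps_exp)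
qed

section \<open>Hyperbolic polynomials and their preservation by the elementary factors\<close>

lemma prod_linear_hyperbolic:
  assumes "finite A"
  shows "(\<Prod>i\<in>A. [:- of_real (x i), 1:]) \<in> hyperbolic (card A)"
proof -
  have "lead_coeff (\<Prod>i\<in>A. [:- complex_of_real (x i), 1:]) = 1"
    unfolding lead_coeff_prod by simp
  then show ?thesis
    using assms by (auto simp: hyperbolic_def degree_prod_sum_eq poly_prod)
qed

text \<open>Listing the zeros by an index below n keeps multiplicities and allows perturbations and
  limits coordinate by coordinate.\<close>

lemma hyperbolic_iff_prod:
  "P \<in> hyperbolic n \<longleftrightarrow> (\<exists>x::nat \<Rightarrow> real. P = (\<Prod>i<n. [:- of_real (x i), 1:]))"
proof
  assume P: "P \<in> hyperbolic n"
  obtain r where r: "smult (lead_coeff P) (\<Prod>i<degree P. [:- r i, 1:]) = P"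
    using complex_poly_decompose' .
  have eq: "P = (\<Prod>i<n. [:- r i, 1:])"
    using P r by (simp add: hyperbolic_def) (metis smult_1_left)
  have "r i \<in> \<real>" if "i < n" for i
  proof -
    have "poly P (r i) = 0" using that by (subst eq) (auto simp: poly_prod)
    then show ?thesis using P by (simp add: hyperbolic_def)
  qed
  then have "P = (\<Prod>i<n. [:- of_real (Re (r i)), 1:])"
    by (subst eq, intro prod.cong) simp_all
  then show "\<exists>x::nat \<Rightarrow> real. P = (\<Prod>i<n. [:- of_real (x i), 1:])"
    by (rule exI[of _ "\<lambda>i. Re (r i)"])
next
  assume "\<exists>x::nat \<Rightarrow> real. P = (\<Prod>i<n. [:- of_real (x i), 1:])"
  then show "P \<in> hyperbolic n"
    using prod_linear_hyperbolic[of "{..<n}"] by auto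
qed

lemma real_zeros_prod_linear:
  "finite A \<Longrightarrow> real_zeros (\<Prod>i\<in>A. [:- of_real (x i), 1:]) = image_mset x (mset_set A)"
  by (simp add: real_zeros_def proots_prod)
     (induction A rule: finite_induct; simp)

lemma log_pderiv_prod_linear:
  fixes z :: complex and x :: "'a \<Rightarrow> real"
  assumes "finite A" "\<And>i. i \<in> A \<Longrightarrow> z \<noteq> of_real (x i)"
  defines "P \<equiv> (\<Prod>i\<in>A. [:- of_real (x i), 1:])"
  shows "poly (pderiv P) z = poly P z * (\<Sum>i\<in>A. 1 / (z - of_real (x i)))"
proof -
  have "poly (pderiv P) z = (\<Sum>i\<in>A. \<Prod>j\<in>A - {i}. z - of_real (x j))"
    by (simp add: P_def pderiv_prod pderiv_pCons poly_sum poly_prod)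
  also have "\<dots> = (\<Sum>i\<in>A. (\<Prod>j\<in>A. z - of_real (x j)) * (1 / (z - of_real (x i))))"
    using assms by (intro sum.cong refl) (simp add: prod.remove)
  also have "\<dots> = poly P z * (\<Sum>i\<in>A. 1 / (z - of_real (x i)))"
    by (simp add: P_def poly_prod sum_distrib_left)
  finally show ?thesis .
qed

text \<open>For nonreal z every summand has an imaginary part of the sign opposite to that of Im z,
  so a nonempty sum cannot be real.\<close>

lemma sum_inverse_real_imp_real:
  fixes z :: complex and x :: "'a \<Rightarrow> real"
  assumes "finite A" "of_real \<alpha> * (\<Sum>i\<in>A. 1 / (z - of_real (x i))) = 1"
  shows "z \<in> \<real>"
proof (rule ccontr)
  assume "z \<notin> \<real>"
  then have im: "Im z \<noteq> 0" by (simp add: complex_is_Real_iff)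
  have "\<alpha> \<noteq> 0" "A \<noteq> {}" using assms by auto
  have "0 = Im (of_real \<alpha> * (\<Sum>i\<in>A. 1 / (z - of_real (x i))))"
    by (simp only: assms) simp
  also have "\<dots> = \<alpha> * (\<Sum>i\<in>A. - Im z / ((Re z - x i)\<^sup>2 + (Im z)\<^sup>2))"
    by (simp add: Im_divide)
  also have "\<dots> = - \<alpha> * Im z * (\<Sum>i\<in>A. 1 / ((Re z - x i)\<^sup>2 + (Im z)\<^sup>2))"
    by (simp add: sum_distrib_left)
  finally have "(\<Sum>i\<in>A. 1 / ((Re z - x i)\<^sup>2 + (Im z)\<^sup>2)) = 0"
    using im \<open>\<alpha> \<noteq> 0\<close> by simp
  moreover have "(\<Sum>i\<in>A. 1 / ((Re z - x i)\<^sup>2 + (Im z)\<^sup>2)) > 0"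
    using assms(1) \<open>A \<noteq> {}\<close> im by (intro sum_pos) (auto simp: add_nonneg_pos)
  ultimately show False by simp
qed

text \<open>Away from the zeros of P the new polynomial is P (1 - \<alpha> P'/P); a nonreal zero
  would contradict \<open>sum_inverse_real_imp_real\<close>. The derivative has no influence on the
  leading term.\<close>

lemma hyperbolic_sub_pderiv:
  assumes "P \<in> hyperbolic n"
  shows "P - smult (of_real \<alpha>) (pderiv P) \<in> hyperbolic n"
proof -
  let ?Q = "P - smult (of_real \<alpha>) (pderiv P)"
  obtain x :: "nat \<Rightarrow> real" where P: "P = (\<Prod>i<n. [:- of_real (x i), 1:])"
    using assms hyperbolic_iff_prod by blast
  have deg: "degree P = n" and lead: "coeff P n = 1"
    using assms by (auto simp: hyperbolic_def)
  have "coeff ?Q n = 1"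
    using deg lead by (simp add: coeff_pderiv coeff_eq_0)
  moreover have "degree ?Q \<le> n"
    using deg by (intro degree_diff_le) (auto intro: order_trans[OF degree_smult_le] simp: degree_pderiv)
  ultimately have "degree ?Q = n"
    by (metis le_antisym le_degree zero_neq_one)
  moreover have "z \<in> \<real>" if "poly ?Q z = 0" for z
  proof (rule ccontr)
    assume z: "z \<notin> \<real>"
    then have "poly (pderiv P) z = poly P z * (\<Sum>i<n. 1 / (z - of_real (x i)))"
      unfolding P by (intro log_pderiv_prod_linear) auto
    then have "poly ?Q z = poly P z * (1 - of_real \<alpha> * (\<Sum>i<n. 1 / (z - of_real (x i))))"
      by (simp add: algebra_simps)
    moreover have "poly P z \<noteq> 0"
      using assms z by (auto simp: hyperbolic_def)
    ultimately have "of_real \<alpha> * (\<Sum>i<n. 1 / (z - of_real (x i))) = 1"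
      using that by simp
    then show False using sum_inverse_real_imp_real[of "{..<n}"] z by blast
  qed
  ultimately show ?thesis using \<open>coeff ?Q n = 1\<close> by (auto simp: hyperbolic_def)
qed

lemma pcompose_prod_linear:
  "pcompose (\<Prod>i\<in>A. [:- of_real (x i), 1:]) [:of_real c, 1:] = (\<Prod>i\<in>A. [:- of_real (x i - c), 1 :: complex:])"
  by (simp add: pcompose_prod pcompose_pCons)

lemma hyperbolic_shift:
  assumes "P \<in> hyperbolic n"
  shows "pcompose P [:of_real c, 1:] \<in> hyperbolic n"
  using assms unfolding hyperbolic_iff_prod by (metis pcompose_prod_linear)

lemma hyperbolic_lp_factor: "P \<in> hyperbolic n \<Longrightarrow> diff_fps (lp_factor \<alpha>) P \<in> hyperbolic n"
  by (simp add: diff_fps_lp_factor hyperbolic_shift hyperbolic_sub_pderiv)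

section \<open>Polynomials with simple real zeros\<close>

text \<open>The secular roots are all the zeros and are simple, so their number is the degree. This
  is the count that makes the eigenvectors a basis.\<close>

lemma sub_pderiv_distinct:
  fixes X :: "real set" and \<alpha> :: real
  assumes X: "finite X" and \<alpha>: "\<alpha> \<noteq> 0"
  defines "P \<equiv> (\<Prod>x\<in>X. [:- of_real x, 1 :: complex:])"
  shows "P - smult (of_real \<alpha>) (pderiv P) = (\<Prod>y\<in>secular_roots X \<alpha>. [:- of_real y, 1:])"
    and "card (secular_roots X \<alpha>) = card X"
proof -
  let ?Q = "P - smult (of_real \<alpha>) (pderiv P)" and ?R = "\<lambda>z. \<Sum>x\<in>X. 1 / (z - complex_of_real x)"
  have P: "P \<in> hyperbolic (card X)"
    unfolding P_def by (rule prod_linear_hyperbolic[OF X])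
  have Q: "?Q \<in> hyperbolic (card X)"
    by (rule hyperbolic_sub_pderiv[OF P])
  have P0: "poly P z = 0 \<longleftrightarrow> z \<in> of_real ` X" for z
    using X by (auto simp: P_def poly_prod)
  have fact: "poly ?Q z = poly P z * (1 - of_real \<alpha> * ?R z)" if "z \<notin> of_real ` X" for z
    using log_pderiv_prod_linear[OF X, of z "\<lambda>x. x"] that
    by (auto simp: P_def image_iff algebra_simps)
  \<comment> \<open>At a point of \<open>X\<close> the polynomial P vanishes but its derivative does
    not, the zeros being simple; as \<alpha> is nonzero, \<open>?Q\<close> cannot vanish
    there.\<close>
  have notX: "z \<notin> of_real ` X" if "poly ?Q z = 0" for z
  proof
    assume "z \<in> of_real ` X"
    then obtain a where a: "a \<in> X" "z = of_real a" by auto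
    have split: "P = [:- of_real a, 1:] * (\<Prod>x\<in>X - {a}. [:- of_real x, 1:])"
      unfolding P_def by (rule prod.remove[OF X a(1)])
    have "poly (pderiv P) z = (\<Prod>x\<in>X - {a}. z - of_real x)"
      using a by (subst split) (simp add: pderiv_mult pderiv_pCons poly_prod del: mult_pCons_left)
    also have "\<dots> \<noteq> 0" using X a by auto
    finally show False
      using that \<alpha> P0[of z] \<open>z \<in> of_real ` X\<close> by simp
  qed
  have root_iff: "poly ?Q z = 0 \<longleftrightarrow> z \<in> of_real ` secular_roots X \<alpha>" for z
  proof
    assume z: "poly ?Q z = 0"
    have eq: "of_real \<alpha> * ?R z = 1"
      using fact[OF notX[OF z]] z P0[of z] notX[OF z] by simp
    obtain y where y: "z = of_real y"
      using Q z by (auto simp: hyperbolic_def elim: Reals_cases)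
    have "complex_of_real (\<alpha> * (\<Sum>x\<in>X. 1 / (y - x))) = of_real 1"
      using eq by (simp add: y)
    then have "\<alpha> * (\<Sum>x\<in>X. 1 / (y - x)) = 1"
      by (simp only: of_real_eq_iff)
    then show "z \<in> of_real ` secular_roots X \<alpha>"
      using notX[OF z] y by (auto simp: secular_roots_def)
  next
    assume "z \<in> of_real ` secular_roots X \<alpha>"
    then obtain y where y: "z = of_real y" "y \<notin> X" and eq: "\<alpha> * (\<Sum>x\<in>X. 1 / (y - x)) = 1"
      by (auto simp: secular_roots_def)
    have "of_real \<alpha> * ?R z = complex_of_real (\<alpha> * (\<Sum>x\<in>X. 1 / (y - x)))"
      by (simp add: y)
    also have "\<dots> = 1" by (simp only: eq of_real_1)
    finally have eq': "of_real \<alpha> * ?R z = 1" .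
    have "z \<notin> of_real ` X" using y by auto
    from fact[OF this] show "poly ?Q z = 0"
      unfolding eq' by (simp only: diff_self mult_zero_right)
  qed
  have "poly (pderiv ?Q) z \<noteq> 0" if z: "poly ?Q z = 0" for z
  proof -
    obtain y where y: "z = of_real y" "y \<in> secular_roots X \<alpha>"
      using root_iff z by blast
    let ?S = "\<Sum>x\<in>X. (1 / (y - x))\<^sup>2"
    have eq: "of_real \<alpha> * ?R z = 1"
      using fact[OF notX[OF z]] z P0[of z] notX[OF z] by simp
    have ne: "z - of_real x \<noteq> 0" if "x \<in> X" for x
      using notX[OF z] that by auto
    \<comment> \<open>In the product rule the term with P' drops out by the secular equation;
      differentiating \<open>?R\<close> leaves a sum of squares, which is positive at a real
      point.\<close>
    have "((\<lambda>w. poly P w * (1 - of_real \<alpha> * ?R w)) has_field_derivative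
        poly P z * (of_real \<alpha> * (\<Sum>x\<in>X. (1 / (z - of_real x))\<^sup>2))) (at z)"
      using ne eq
      by (auto intro!: derivative_eq_intros poly_DERIV
          simp: sum_negf power2_eq_square simp flip: of_real_diff)
    \<comment> \<open>The factorization holds only off the zeros of P, but on an open set around z,
      which is enough to identify the derivative of \<open>?Q\<close> at z.\<close>
    moreover have "open (- complex_of_real ` X)"
      using X by (intro open_Compl finite_imp_closed) auto
    ultimately have "(poly ?Q has_field_derivative
        poly P z * (of_real \<alpha> * (\<Sum>x\<in>X. (1 / (z - of_real x))\<^sup>2))) (at z)"
      by (rule has_field_derivative_transform_within_open) (use notX[OF z] fact in auto)
    then have "poly (pderiv ?Q) z = poly P z * (of_real \<alpha> * (\<Sum>x\<in>X. (1 / (z - of_real x))\<^sup>2))"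
      using poly_DERIV DERIV_unique by blast
    also have "\<dots> = poly P z * (of_real \<alpha> * of_real ?S)"
      by (simp add: y)
    also have "\<dots> \<noteq> 0"
      using P0[of z] notX[OF z] \<alpha> secular_sum_squares_pos[OF X y(2)]
      by (simp del: of_real_sum)
    finally show ?thesis .
  qed
  then have "rsquarefree ?Q" by (auto simp: rsquarefree_roots)
  moreover have "{z. poly ?Q z = 0} = of_real ` secular_roots X \<alpha>"
    using root_iff by blast
  moreover have lead: "lead_coeff ?Q = 1"
    using Q unfolding hyperbolic_def by blast
  ultimately have "?Q = smult 1 (\<Prod>z\<in>of_real ` secular_roots X \<alpha>. [:- z, 1:])"
    using complex_poly_decompose_rsquarefree[of ?Q] by metis
  then show eq: "?Q = (\<Prod>y\<in>secular_roots X \<alpha>. [:- of_real y, 1:])"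
    by (simp add: prod.reindex inj_on_def)
  have "finite (complex_of_real ` secular_roots X \<alpha>)"
  proof -
    have "?Q \<noteq> 0" using lead by (metis leading_coeff_0_iff zero_neq_one)
    then show ?thesis using poly_roots_finite[of ?Q] root_iff by (simp add: Collect_mem_eq)
  qed
  then have "finite (secular_roots X \<alpha>)"
    by (rule finite_imageD) (simp add: inj_on_def)
  then have "?Q \<in> hyperbolic (card (secular_roots X \<alpha>))"
    unfolding eq by (rule prod_linear_hyperbolic)
  with Q show "card (secular_roots X \<alpha>) = card X"
    by (simp add: hyperbolic_def)
qed

text \<open>The exponential shifts each secular root y to y - \<alpha>, which is the eigenvalue
  found in \<open>secular_eigen\<close>.\<close>

lemma real_zeros_lp_factor_distinct:
  assumes "finite X" "\<alpha> \<noteq> 0"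
  shows "real_zeros (diff_fps (lp_factor \<alpha>) (\<Prod>x\<in>X. [:- of_real x, 1:])) =
    image_mset (\<lambda>y. y - \<alpha>) (mset_set (secular_roots X \<alpha>))"
proof -
  have "finite (secular_roots X \<alpha>)"
    using sub_pderiv_distinct(2)[OF assms] assms
    by (cases "X = {}") (auto simp: secular_roots_def intro: card_ge_0_finite)
  then show ?thesis
    unfolding diff_fps_lp_factor sub_pderiv_distinct(1)[OF assms] pcompose_prod_linear
    by (rule real_zeros_prod_linear)
qed

text \<open>For \<beta> = 0 both sides coincide. Secular roots describe the zeros only for a nonzero
  parameter, so \<theta> = 0 is separate: the left operator is then the identity and Schur's
  inequality applies.\<close>

lemma majorized_lp_factor_distinct:
  fixes X :: "real set"
  assumes X: "finite X" and \<theta>: "0 \<le> \<theta>" "\<theta> \<le> 1"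
  defines "P \<equiv> (\<Prod>x\<in>X. [:- of_real x, 1 :: complex:])"
  shows "majorized (real_zeros (diff_fps (lp_factor (\<theta> * \<beta>)) P)) (real_zeros (diff_fps (lp_factor \<beta>) P))"
proof (cases "\<beta> = 0")
  case False
  note \<beta> = real_zeros_lp_factor_distinct[OF X False] sub_pderiv_distinct(2)[OF X False]
  show ?thesis
  proof (cases "\<theta> = 0")
    case True
    have "diff_fps (lp_factor 0) P = P" by (simp add: diff_fps_lp_factor)
    moreover have "real_zeros P = mset_set X"
      using real_zeros_prod_linear[OF X, of "\<lambda>x. x"] by (simp add: P_def)
    ultimately show ?thesis
      using \<beta> secular_trace_ge[OF X \<beta>(2)]
      by (simp add: True majorized_def sum_unfold_sum_mset P_def multiset.map_comp comp_def)
  next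
    case nz: False
    then have "\<theta> * \<beta> \<noteq> 0" using False by simp
    note \<alpha> = real_zeros_lp_factor_distinct[OF X this] sub_pderiv_distinct(2)[OF X this]
    show ?thesis
      using \<alpha> \<beta> secular_trace_mono[OF X _ \<theta> \<alpha>(2) \<beta>(2)]
      by (simp add: majorized_def sum_unfold_sum_mset P_def multiset.map_comp comp_def)
  qed
qed (simp add: majorized_def)

section \<open>Limits of hyperbolic polynomials\<close>

text \<open>Bolzano-Weierstrass applied to one coordinate after another; each refinement keeps the
  limits already obtained.\<close>

lemma bounded_coordinates_imp_convergent_subseq:
  fixes x :: "nat \<Rightarrow> nat \<Rightarrow> real"
  assumes "\<And>i. i < n \<Longrightarrow> bounded (range (\<lambda>k. x k i))"
  obtains r l where "strict_mono r" "\<And>i. i < n \<Longrightarrow> (\<lambda>k. x (r k) i) \<longlonglongrightarrow> l i"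
proof -
  have "\<exists>r l. strict_mono r \<and> (\<forall>i<n. (\<lambda>k. x (r k) i) \<longlonglongrightarrow> l i)"
    using assms
  proof (induction n)
    case 0
    then show ?case using strict_mono_id by blast
  next
    case (Suc n)
    obtain r l where r: "strict_mono r" and l: "\<And>i. i < n \<Longrightarrow> (\<lambda>k. x (r k) i) \<longlonglongrightarrow> l i"
      using Suc by (metis less_SucI)
    have "bounded (range (\<lambda>k. x (r k) n))"
      using Suc.prems[of n] by (rule bounded_subset) auto
    then obtain a q where q: "strict_mono q" "((\<lambda>k. x (r k) n) \<circ> q) \<longlonglongrightarrow> a"
      using bounded_imp_convergent_subsequence by blast
    have "(\<lambda>k. x ((r \<circ> q) k) i) \<longlonglongrightarrow> (l(n := a)) i" if "i < Suc n" for i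
    proof (cases "i = n")
      case True
      then show ?thesis using q(2) by (simp add: comp_def)
    next
      case False
      then have "i < n" using that by simp
      then show ?thesis using False LIMSEQ_subseq_LIMSEQ[OF l q(1)] by (simp add: comp_def)
    qed
    then show ?case using strict_mono_o[OF r q(1)] by blast
  qed
  then show ?thesis using that by blast
qed

text \<open>At the imaginary unit every linear factor has modulus at least 1, so the modulus of the
  product dominates that of each factor and hence the modulus of each zero.\<close>

lemma bounded_hyperbolic_zeros:
  fixes x :: "nat \<Rightarrow> nat \<Rightarrow> real"
  assumes "convergent (\<lambda>k. poly (\<Prod>i<n. [:- of_real (x k i), 1:]) \<i>)" "i < n"
  shows "bounded (range (\<lambda>k. x k i))"
proof -
  have "Bseq (\<lambda>k. poly (\<Prod>i<n. [:- of_real (x k i), 1:]) \<i>)"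
    using assms(1) by (rule convergent_imp_Bseq)
  then obtain K where K: "\<And>k. norm (poly (\<Prod>i<n. [:- of_real (x k i), 1:]) \<i>) \<le> K"
    by (auto simp: Bseq_def)
  have "\<bar>x k i\<bar> \<le> K" for k
  proof -
    have "1 \<le> norm (\<i> - complex_of_real (x k j))" for j
      using abs_Im_le_cmod[of "\<i> - complex_of_real (x k j)"] by simp
    then have "1 \<le> (\<Prod>j\<in>{..<n} - {i}. norm (\<i> - complex_of_real (x k j)))"
      by (intro prod_ge_1)
    then have "norm (\<i> - complex_of_real (x k i)) * 1 \<le>
        norm (\<i> - complex_of_real (x k i)) * (\<Prod>j\<in>{..<n} - {i}. norm (\<i> - complex_of_real (x k j)))"
      by (rule mult_left_mono) simp
    also have "\<dots> = (\<Prod>j<n. norm (\<i> - complex_of_real (x k j)))"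
      using assms(2) by (subst prod.remove[of "{..<n}" i]) auto
    also have "\<dots> = norm (poly (\<Prod>i<n. [:- of_real (x k i), 1:]) \<i>)"
      by (simp add: poly_prod prod_norm)
    finally show ?thesis
      using K[of k] abs_Re_le_cmod[of "\<i> - complex_of_real (x k i)"] by simp
  qed
  then show ?thesis by (auto simp: bounded_iff)
qed

lemma hyperbolic_zeros_convergent_subseq:
  assumes hyp: "\<And>k. P k \<in> hyperbolic n" and lim: "\<And>z. (\<lambda>k. poly (P k) z) \<longlonglongrightarrow> poly Q z"
  obtains x r l where "strict_mono r" "\<And>i. i < n \<Longrightarrow> (\<lambda>k. x (r k) i) \<longlonglongrightarrow> l i"
    "\<And>k. P k = (\<Prod>i<n. [:- of_real (x k i), 1:])" "Q = (\<Prod>i<n. [:- of_real (l i), 1:])"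
proof -
  have "\<forall>k. \<exists>x::nat \<Rightarrow> real. P k = (\<Prod>i<n. [:- of_real (x i), 1:])"
    using hyp hyperbolic_iff_prod by blast
  then obtain x :: "nat \<Rightarrow> nat \<Rightarrow> real" where x: "\<And>k. P k = (\<Prod>i<n. [:- of_real (x k i), 1:])"
    by metis
  have "bounded (range (\<lambda>k. x k i))" if "i < n" for i
    using lim[of \<i>] that by (intro bounded_hyperbolic_zeros) (auto simp: x convergent_def)
  then obtain r l where r: "strict_mono r" "\<And>i. i < n \<Longrightarrow> (\<lambda>k. x (r k) i) \<longlonglongrightarrow> l i"
    using bounded_coordinates_imp_convergent_subseq by metis
  have "poly Q z = poly (\<Prod>i<n. [:- of_real (l i), 1:]) z" for z
  proof (rule LIMSEQ_unique)
    show "(\<lambda>k. poly (P (r k)) z) \<longlonglongrightarrow> poly Q z"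
      using LIMSEQ_subseq_LIMSEQ[OF lim r(1)] by (simp add: comp_def)
    show "(\<lambda>k. poly (P (r k)) z) \<longlonglongrightarrow> poly (\<Prod>i<n. [:- of_real (l i), 1:]) z"
      unfolding x by (auto simp: poly_prod intro!: tendsto_intros r)
  qed
  then have "Q = (\<Prod>i<n. [:- of_real (l i), 1:])"
    by (simp add: poly_eq_poly_eq_iff[symmetric] fun_eq_iff)
  then show ?thesis using that r x by blast
qed

lemma hyperbolic_limit:
  assumes "\<And>k. P k \<in> hyperbolic n" "\<And>z. (\<lambda>k. poly (P k) z) \<longlonglongrightarrow> poly Q z"
  shows "Q \<in> hyperbolic n"
  using hyperbolic_zeros_convergent_subseq[OF assms] hyperbolic_iff_prod by metis

text \<open>Along a common subsequence the zeros on both sides converge, and a convex function on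
  the real line is continuous, so the inequality of sums survives the limit.\<close>

lemma majorized_limit:
  assumes P: "\<And>k. P k \<in> hyperbolic n" "\<And>z. (\<lambda>k. poly (P k) z) \<longlonglongrightarrow> poly P' z"
    and Q: "\<And>k. Q k \<in> hyperbolic n" "\<And>z. (\<lambda>k. poly (Q k) z) \<longlonglongrightarrow> poly Q' z"
    and maj: "\<And>k. majorized (real_zeros (P k)) (real_zeros (Q k))"
  shows "majorized (real_zeros P') (real_zeros Q')"
proof -
  obtain x r l where x: "strict_mono r" "\<And>i. i < n \<Longrightarrow> (\<lambda>k. x (r k) i) \<longlonglongrightarrow> l i"
    "\<And>k. P k = (\<Prod>i<n. [:- of_real (x k i), 1:])" "P' = (\<Prod>i<n. [:- of_real (l i), 1:])"
    by (rule hyperbolic_zeros_convergent_subseq[OF P]) blast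
  have "(\<lambda>k. poly (Q (r k)) z) \<longlonglongrightarrow> poly Q' z" for z
    using LIMSEQ_subseq_LIMSEQ[OF Q(2) x(1)] by (simp add: comp_def)
  \<comment> \<open>The second extraction runs inside the first subsequence, so that both families
    of zeros converge along \<open>r (q k)\<close>.\<close>
  then obtain y q m where y: "strict_mono q" "\<And>i. i < n \<Longrightarrow> (\<lambda>k. y (q k) i) \<longlonglongrightarrow> m i"
    "\<And>k. Q (r k) = (\<Prod>i<n. [:- of_real (y k i), 1:])" "Q' = (\<Prod>i<n. [:- of_real (m i), 1:])"
    using hyperbolic_zeros_convergent_subseq[of "\<lambda>k. Q (r k)" n Q'] Q(1) by blast
  have sum_zeros: "(\<Sum>t\<in>#real_zeros (\<Prod>i<n. [:- of_real (w i), 1:]). f t) = (\<Sum>i<n. f (w i))"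
    for f :: "real \<Rightarrow> real" and w
    by (simp add: real_zeros_prod_linear multiset.map_comp comp_def sum_unfold_sum_mset)
  have "(\<Sum>i<n. f (l i)) \<le> (\<Sum>i<n. f (m i))" if f: "convex_on UNIV f" for f :: "real \<Rightarrow> real"
  proof (rule LIMSEQ_le)
    have cont: "isCont f t" for t
      using convex_on_continuous[OF open_UNIV f] by (simp add: continuous_on_eq_continuous_at)
    have "(\<lambda>k. x (r (q k)) i) \<longlonglongrightarrow> l i" if "i < n" for i
      using LIMSEQ_subseq_LIMSEQ[OF x(2)[OF that] y(1)] by (simp add: comp_def)
    then show "(\<lambda>k. \<Sum>i<n. f (x (r (q k)) i)) \<longlonglongrightarrow> (\<Sum>i<n. f (l i))"
      by (intro tendsto_sum isCont_tendsto_compose[OF cont]) auto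
    show "(\<lambda>k. \<Sum>i<n. f (y (q k) i)) \<longlonglongrightarrow> (\<Sum>i<n. f (m i))"
      by (intro tendsto_sum isCont_tendsto_compose[OF cont] y(2)) auto
    have "(\<Sum>i<n. f (x (r k) i)) \<le> (\<Sum>i<n. f (y k i))" for k
      using maj[of "r k"] f unfolding majorized_def x(3) y(3) sum_zeros by blast
    then show "\<exists>N. \<forall>k\<ge>N. (\<Sum>i<n. f (x (r (q k)) i)) \<le> (\<Sum>i<n. f (y (q k) i))"
      by blast
  qed
  then show ?thesis
    unfolding majorized_def x(4) y(4) sum_zeros by (simp add: real_zeros_prod_linear)
qed

section \<open>Deformation of the factors\<close>

lemma tendsto_poly_lp_factor:
  fixes x :: "nat \<Rightarrow> nat \<Rightarrow> real"
  assumes "\<And>i. i < n \<Longrightarrow> (\<lambda>k. x k i) \<longlonglongrightarrow> l i"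
  shows "(\<lambda>k. poly (diff_fps (lp_factor \<alpha>) (\<Prod>i<n. [:- of_real (x k i), 1:])) z)
    \<longlonglongrightarrow> poly (diff_fps (lp_factor \<alpha>) (\<Prod>i<n. [:- of_real (l i), 1:])) z"
  unfolding diff_fps_lp_factor
  by (auto simp: poly_pcompose poly_prod pderiv_prod pderiv_pCons poly_sum
      intro!: tendsto_intros assms)

text \<open>Multiple zeros are separated by a small perturbation; the case of distinct zeros then
  passes to the limit.\<close>

lemma majorized_lp_factor:
  assumes P: "P \<in> hyperbolic n" and \<theta>: "0 \<le> \<theta>" "\<theta> \<le> 1"
  shows "majorized (real_zeros (diff_fps (lp_factor (\<theta> * \<beta>)) P)) (real_zeros (diff_fps (lp_factor \<beta>) P))"
proof -
  obtain x :: "nat \<Rightarrow> real" where x: "P = (\<Prod>i<n. [:- of_real (x i), 1:])"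
    using P hyperbolic_iff_prod by blast
  \<comment> \<open>Different offsets separate equal zeros for every k; zeros that already differ
    stay apart for large k.\<close>
  define y where "y k i = x i + real i / real (Suc k)" for k i
  have y: "(\<lambda>k. y k i) \<longlonglongrightarrow> x i" for i
    unfolding y_def by real_asymp
  have "\<forall>\<^sub>F k in sequentially. \<forall>i\<in>{..<n}. \<forall>j\<in>{..<n}. i \<noteq> j \<longrightarrow> y k i \<noteq> y k j"
  proof (intro eventually_ball_finite ballI finite_lessThan)
    fix i j
    have "(\<lambda>k. y k i - y k j) \<longlonglongrightarrow> x i - x j"
      by (intro tendsto_diff y)
    then have "x i \<noteq> x j \<Longrightarrow> \<forall>\<^sub>F k in sequentially. y k i - y k j \<noteq> 0"
      by (rule tendsto_imp_eventually_ne) simp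
    then show "\<forall>\<^sub>F k in sequentially. i \<noteq> j \<longrightarrow> y k i \<noteq> y k j"
      by (cases "x i = x j") (auto simp: y_def elim: eventually_mono)
  qed
  then obtain N where N: "\<And>k. k \<ge> N \<Longrightarrow> inj_on (y k) {..<n}"
    unfolding eventually_sequentially inj_on_def by blast
  \<comment> \<open>Starting at \<open>N\<close> makes the zeros distinct for every index, as
    \<open>majorized_limit\<close> asks for the comparison at all indices.\<close>
  define Q where "Q k = (\<Prod>i<n. [:- complex_of_real (y (k + N) i), 1:])" for k
  have hyp: "Q k \<in> hyperbolic n" for k
    unfolding Q_def hyperbolic_iff_prod by blast
  have lim: "(\<lambda>k. poly (diff_fps (lp_factor \<alpha>) (Q k)) z) \<longlonglongrightarrow> poly (diff_fps (lp_factor \<alpha>) P) z" for \<alpha> z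
    unfolding Q_def x by (intro tendsto_poly_lp_factor LIMSEQ_ignore_initial_segment y)
  have "majorized (real_zeros (diff_fps (lp_factor (\<theta> * \<beta>)) (Q k))) (real_zeros (diff_fps (lp_factor \<beta>) (Q k)))" for k
  proof -
    have "Q k = (\<Prod>t\<in>y (k + N) ` {..<n}. [:- of_real t, 1:])"
      using N[of "k + N"] by (simp add: Q_def prod.reindex)
    then show ?thesis
      using majorized_lp_factor_distinct[OF _ \<theta>, of "y (k + N) ` {..<n}"] by simp
  qed
  then show ?thesis
    by (rule majorized_limit[OF hyperbolic_lp_factor[OF hyp] lim hyperbolic_lp_factor[OF hyp] lim])
qed

lemma majorized_refl: "majorized X X"
  by (simp add: majorized_def)

lemma majorized_trans: "majorized X Y \<Longrightarrow> majorized Y Z \<Longrightarrow> majorized X Z"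
  unfolding majorized_def by (metis order_trans)

definition lp_prod :: "real list \<Rightarrow> complex fps" where
  "lp_prod \<alpha>s = prod_list (map lp_factor \<alpha>s)"

lemma hyperbolic_lp_prod: "P \<in> hyperbolic n \<Longrightarrow> diff_fps (lp_prod \<alpha>s) P \<in> hyperbolic n"
  by (induction \<alpha>s arbitrary: P) (simp_all add: lp_prod_def diff_fps_1 diff_fps_mult hyperbolic_lp_factor)

text \<open>The factors commute, so each one can be deformed while it acts last, on a polynomial that
  is again hyperbolic.\<close>

lemma majorized_lp_prod:
  assumes "list_all2 (\<lambda>\<alpha> \<beta>. \<bar>\<alpha>\<bar> \<le> \<bar>\<beta>\<bar> \<and> \<alpha> * \<beta> \<ge> 0) \<alpha>s \<beta>s" "P \<in> hyperbolic n"
  shows "majorized (real_zeros (diff_fps (lp_prod \<alpha>s) P)) (real_zeros (diff_fps (lp_prod \<beta>s) P))"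
  using assms
proof (induction arbitrary: P rule: list_all2_induct)
  case Nil
  show ?case by (rule majorized_refl)
next
  case (Cons \<alpha> \<alpha>s \<beta> \<beta>s)
  \<comment> \<open>Modulus and sign together say that \<alpha> lies between 0 and \<beta>; if
    \<beta> = 0 then \<alpha> = 0 as well.\<close>
  obtain \<theta> where \<theta>: "0 \<le> \<theta>" "\<theta> \<le> 1" "\<alpha> = \<theta> * \<beta>"
  proof (cases "\<beta> = 0")
    case False
    show thesis
    proof (rule that[of "\<alpha> / \<beta>"])
      show "0 \<le> \<alpha> / \<beta>" using Cons(1) by (auto simp: zero_le_divide_iff zero_le_mult_iff)
      show "\<alpha> / \<beta> \<le> 1" using Cons(1) False by (auto simp: divide_le_eq zero_le_mult_iff abs_if split: if_splits)
    qed (use False in simp)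
  qed (use Cons(1) that[of 0] in auto)
  have commute: "diff_fps (lp_prod (\<gamma> # \<gamma>s)) P = diff_fps (lp_prod \<gamma>s) (diff_fps (lp_factor \<gamma>) P)" for \<gamma> \<gamma>s
    by (simp add: lp_prod_def mult.commute[of "lp_factor \<gamma>"] diff_fps_mult)
  \<comment> \<open>First the tail is deformed, with the factor for \<alpha> moved into the
    polynomial; next the head is deformed while it acts last.\<close>
  have "majorized (real_zeros (diff_fps (lp_prod (\<alpha> # \<alpha>s)) P)) (real_zeros (diff_fps (lp_prod (\<alpha> # \<beta>s)) P))"
    unfolding commute by (rule Cons.IH) (rule hyperbolic_lp_factor[OF Cons.prems])
  also have "majorized (real_zeros (diff_fps (lp_prod (\<alpha> # \<beta>s)) P)) (real_zeros (diff_fps (lp_prod (\<beta> # \<beta>s)) P))"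
    using majorized_lp_factor[OF hyperbolic_lp_prod[OF Cons.prems, of \<beta>s] \<theta>(1,2), of \<beta>]
    by (simp add: lp_prod_def diff_fps_mult \<theta>(3))
  finally (majorized_trans) show ?case .
qed

section \<open>Uniform approximation of the symbol by finite products\<close>

lemma power_diff_bound:
  fixes u v :: complex
  assumes "norm u \<le> s" "norm v \<le> s" "s \<ge> 1"
  shows "norm (u ^ n - v ^ n) \<le> s ^ n * (real n * norm (u - v))"
proof -
  have "norm ((u / of_real s) ^ n - (v / of_real s) ^ n) \<le> real n * norm (u / of_real s - v / of_real s)"
    using assms by (intro norm_power_diff) (auto simp: norm_divide)
  also have "\<dots> \<le> real n * norm (u - v)"
    using assms by (intro mult_left_mono)
      (simp_all add: diff_divide_distrib[symmetric] norm_divide divide_le_eq mult_le_cancel_left1)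
  finally have "norm (u ^ n - v ^ n) / s ^ n \<le> real n * norm (u - v)"
    using assms by (simp add: power_divide diff_divide_distrib[symmetric] norm_divide norm_power)
  then show ?thesis using assms by (simp add: divide_le_eq mult.commute)
qed

text \<open>\<open>1 + w / N\<close> and \<open>exp (w / N)\<close> both have modulus at most
  \<open>exp (R / N)\<close>. Comparing N-th powers costs a factor \<open>N * exp R\<close>, while
  the Taylor remainder is of order \<open>1 / N\<close> squared.\<close>

lemma exp_sequence_bound:
  fixes w :: complex
  assumes "norm w \<le> R" and N: "N \<noteq> 0"
  shows "norm ((1 + w / of_nat N) ^ N - exp w) \<le> exp R * (exp R * R\<^sup>2 / real N)"
proof -
  let ?h = "w / of_nat N"
  have R: "0 \<le> R" using assms norm_ge_zero order_trans by blast
  have h: "norm ?h \<le> R / N" using assms by (simp add: norm_divide divide_right_mono)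
  have "norm (1 + ?h) \<le> exp (R / N)"
  proof -
    have "norm (1 + ?h) \<le> 1 + norm ?h" using norm_triangle_ineq[of 1 ?h] by simp
    then show ?thesis using h exp_ge_add_one_self[of "R / N"] by linarith
  qed
  moreover have "norm (exp ?h) \<le> exp (R / N)"
    using norm_exp[of ?h] h by (meson exp_le_cancel_iff order_trans)
  ultimately have "norm ((1 + ?h) ^ N - exp ?h ^ N) \<le>
      exp (R / N) ^ N * (real N * norm (1 + ?h - exp ?h))"
    using R by (intro power_diff_bound) auto
  also have "exp (R / N) ^ N = exp R"
    using N by (simp add: exp_of_nat_mult[symmetric])
  also have "exp ?h ^ N = exp w"
    using N by (simp add: exp_of_nat_mult[symmetric])
  also have "norm (1 + ?h - exp ?h) \<le> exp (norm ?h) * (norm ?h)\<^sup>2"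
    using Taylor_exp_field[of ?h 1] by (simp add: norm_minus_commute power2_eq_square)
  also have "\<dots> \<le> exp R * (R / N)\<^sup>2"
  proof (intro mult_mono power_mono h)
    have "R / N \<le> R" using R N by (simp add: divide_le_eq mult_le_cancel_left1)
    then show "exp (norm ?h) \<le> exp R" using h by (meson exp_le_cancel_iff order_trans)
  qed auto
  finally show ?thesis
    using N by (simp add: power2_eq_square field_simps)
qed

lemma uniform_limit_gaussian:
  fixes c :: complex
  shows "uniform_limit (cball 0 1) (\<lambda>N z. (1 + c * z\<^sup>2 / of_nat N) ^ N) (\<lambda>z. exp (c * z\<^sup>2)) sequentially"
proof (rule uniform_limitI)
  fix e :: real assume "e > 0"
  have "(\<lambda>N. exp (norm c) * (exp (norm c) * (norm c)\<^sup>2 / real N)) \<longlonglongrightarrow> 0"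
    by real_asymp
  then have "\<forall>\<^sub>F N in sequentially. exp (norm c) * (exp (norm c) * (norm c)\<^sup>2 / real N) < e"
    using \<open>e > 0\<close> by (rule order_tendstoD)
  from this eventually_gt_at_top[of 0]
  show "\<forall>\<^sub>F N in sequentially. \<forall>z\<in>cball 0 1. dist ((1 + c * z\<^sup>2 / of_nat N) ^ N) (exp (c * z\<^sup>2)) < e"
  proof eventually_elim
    case (elim N)
    have "norm (c * z\<^sup>2) \<le> norm c" if "z \<in> cball 0 1" for z
      using that by (simp add: norm_mult norm_power mult_left_le power_le_one)
    then show ?case
      using elim exp_sequence_bound[of "c * z\<^sup>2" "norm c" N for z] order_le_less_trans
      unfolding dist_norm by blast
  qed
qed

text \<open>On the unit disc a Weierstrass factor of genus 1 differs from 1 by at most three times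
  the square of its coefficient once that is below 1/2, so square summability gives uniform
  convergence. Continuity is used later to bound the limit.\<close>

lemma
  fixes \<alpha> :: "nat \<Rightarrow> real"
  assumes "summable (\<lambda>k. (\<alpha> k)\<^sup>2)"
  defines "f \<equiv> (\<lambda>k z. (1 - complex_of_real (\<alpha> k) * z) * exp (of_real (\<alpha> k) * z))"
  shows uniform_limit_lp_product: "uniform_limit (cball 0 1) (\<lambda>N z. \<Prod>k<N. f k z) (\<lambda>z. \<Prod>k. f k z) sequentially"
    and continuous_on_lp_product: "continuous_on (cball 0 1) (\<lambda>z. \<Prod>k. f k z)"
proof -
  have f: "f k z = weierstrass_factor 1 (of_real (\<alpha> k) * z)" for k z
    by (simp add: f_def weierstrass_factor_def)
  have "(\<lambda>k. (\<alpha> k)\<^sup>2) \<longlonglongrightarrow> 0"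
    by (rule summable_LIMSEQ_zero[OF assms(1)])
  then have "\<forall>\<^sub>F k in sequentially. (\<alpha> k)\<^sup>2 < (1 / 2)\<^sup>2"
    by (rule order_tendstoD) simp
  then have bound: "\<forall>\<^sub>F k in sequentially. \<forall>z\<in>cball 0 1. norm (f k z - 1) \<le> 3 * (\<alpha> k)\<^sup>2"
  proof eventually_elim
    case (elim k)
    show ?case
    proof
      fix z :: complex assume z: "z \<in> cball 0 1"
      have "\<bar>\<alpha> k\<bar> < 1 / 2" using elim power2_less_imp_less[of "\<bar>\<alpha> k\<bar>" "1 / 2"] by simp
      have le: "norm (of_real (\<alpha> k) * z) \<le> \<bar>\<alpha> k\<bar>"
        using z by (simp add: norm_mult mult_left_le)
      then have "norm (f k z - 1) \<le> 3 * norm (of_real (\<alpha> k) * z) ^ Suc 1"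
        unfolding f using \<open>\<bar>\<alpha> k\<bar> < 1 / 2\<close> by (intro weierstrass_factor_bound) simp
      also have "\<dots> \<le> 3 * \<bar>\<alpha> k\<bar> ^ Suc 1"
        by (intro mult_left_mono power_mono le) auto
      finally show "norm (f k z - 1) \<le> 3 * (\<alpha> k)\<^sup>2" by (simp add: power2_eq_square)
    qed
  qed
  have summable: "summable (\<lambda>k. 3 * (\<alpha> k)\<^sup>2)"
    by (rule summable_mult[OF assms(1)])
  have "uniformly_convergent_on (cball 0 1) (\<lambda>N z. \<Sum>k<N. norm (f k z - 1))"
    unfolding uniformly_convergent_on_def
    by (rule exI, rule Weierstrass_m_test_ev[OF _ summable]) (use bound in simp)
  then have "uniformly_convergent_on (cball 0 1) (\<lambda>N z. \<Prod>k<N. f k z)"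
    by (intro uniformly_convergent_on_prod') (auto simp: f_def intro!: continuous_intros)
  then obtain g where g: "uniform_limit (cball 0 1) (\<lambda>N z. \<Prod>k<N. f k z) g sequentially"
    by (auto simp: uniformly_convergent_on_def)
  have "g z = (\<Prod>k. f k z)" if z: "z \<in> cball 0 1" for z
  proof (rule LIMSEQ_unique)
    show "(\<lambda>N. \<Prod>k<N. f k z) \<longlonglongrightarrow> g z"
      by (rule tendsto_uniform_limitI[OF g z])
    have "abs_convergent_prod (\<lambda>k. f k z)"
      unfolding abs_convergent_prod_conv_summable
      by (rule summable_comparison_test_ev[OF _ summable])
        (use bound z in \<open>auto elim: eventually_mono\<close>)
    then have "(\<lambda>N. \<Prod>k\<le>N. f k z) \<longlonglongrightarrow> (\<Prod>k. f k z)"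
      by (intro convergent_prod_LIMSEQ abs_convergent_prod_imp_convergent_prod)
    then show "(\<lambda>N. \<Prod>k<N. f k z) \<longlonglongrightarrow> (\<Prod>k. f k z)"
      by (simp add: LIMSEQ_lessThan_iff_atMost)
  qed
  then show lim: "uniform_limit (cball 0 1) (\<lambda>N z. \<Prod>k<N. f k z) (\<lambda>z. \<Prod>k. f k z) sequentially"
    by (intro uniform_limit_cong'[THEN iffD1, OF _ _ g]) auto
  show "continuous_on (cball 0 1) (\<lambda>z. \<Prod>k. f k z)"
    by (rule uniform_limit_theorem[OF _ lim]) (auto simp: f_def intro!: continuous_intros always_eventually)
qed

text \<open>The N pairs with opposite parameters \<plusminus>a / sqrt N encode the Gaussian: their
  exponentials cancel, leaving the N-th power of 1 - a^2 z^2 / N.\<close>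

definition lp_coeffs :: "real \<Rightarrow> (nat \<Rightarrow> real) \<Rightarrow> nat \<Rightarrow> real list" where
  "lp_coeffs a \<alpha> N = map (\<lambda>k. \<alpha> (Suc k)) [0..<N] @ replicate N (a / sqrt N) @ replicate N (- (a / sqrt N))"

definition lp_approx :: "real \<Rightarrow> (nat \<Rightarrow> real) \<Rightarrow> nat \<Rightarrow> complex \<Rightarrow> complex" where
  "lp_approx a \<alpha> N z = (1 + of_real (- (a\<^sup>2)) * z\<^sup>2 / of_nat N) ^ N *
     (\<Prod>k<N. (1 - of_real (\<alpha> (Suc k)) * z) * exp (of_real (\<alpha> (Suc k)) * z))"

lemma has_fps_expansion_lp_factor:
  "(\<lambda>z. (1 - of_real \<alpha> * z) * exp (of_real \<alpha> * z)) has_fps_expansion lp_factor \<alpha>"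
  unfolding lp_factor_def mult.commute[of "fps_exp _"]
  by (intro fps_expansion_intros)

lemma has_fps_expansion_lp_prod:
  "(\<lambda>z. \<Prod>\<alpha>\<leftarrow>\<alpha>s. (1 - of_real \<alpha> * z) * exp (of_real \<alpha> * z)) has_fps_expansion lp_prod \<alpha>s"
  by (induction \<alpha>s)
    (auto simp: lp_prod_def simp del: of_real_mult intro!: fps_expansion_intros has_fps_expansion_lp_factor)

lemma has_fps_expansion_lp_approx:
  "lp_approx a \<alpha> N has_fps_expansion lp_prod (lp_coeffs a \<alpha> N)"
proof -
  have "lp_approx a \<alpha> N z = (\<Prod>\<alpha>\<leftarrow>lp_coeffs a \<alpha> N. (1 - of_real \<alpha> * z) * exp (of_real \<alpha> * z))" for z
  proof -
    define g where "g \<beta> = (1 - of_real \<beta> * z) * exp (of_real \<beta> * z)" for \<beta>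
    let ?r = "a / sqrt N"
    have "(complex_of_real ?r)\<^sup>2 = of_real (a\<^sup>2) / of_nat N"
      by (simp add: power_divide flip: of_real_power)
    moreover have "g \<beta> * g (- \<beta>) = 1 - (of_real \<beta>)\<^sup>2 * z\<^sup>2" for \<beta>
      by (simp add: g_def exp_minus field_simps power2_eq_square)
    ultimately have pair: "g ?r * g (- ?r) = 1 + of_real (- (a\<^sup>2)) * z\<^sup>2 / of_nat N"
      by simp
    have "(\<Prod>k\<leftarrow>[0..<N]. g (\<alpha> (Suc k))) = (\<Prod>k<N. g (\<alpha> (Suc k)))"
      by (induction N) (simp_all add: mult.commute)
    then have "(\<Prod>\<beta>\<leftarrow>lp_coeffs a \<alpha> N. g \<beta>) = (\<Prod>k<N. g (\<alpha> (Suc k))) * (g ?r * g (- ?r)) ^ N"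
      by (simp only: lp_coeffs_def map_append prod_list.append map_replicate prod_list_replicate
          map_map comp_def power_mult_distrib)
    from this[unfolded pair] show ?thesis
      unfolding lp_approx_def g_def by (simp only: mult.commute)
  qed
  then have "lp_approx a \<alpha> N =
      (\<lambda>z. \<Prod>\<alpha>\<leftarrow>lp_coeffs a \<alpha> N. (1 - of_real \<alpha> * z) * exp (of_real \<alpha> * z))" by blast
  then show ?thesis using has_fps_expansion_lp_prod by simp
qed


text \<open>Uniform convergence of holomorphic functions near 0 carries over to all derivatives at
  0. Products of uniform limits need bounded limits; compactness of the closed disc provides
  this.\<close>

lemma deriv_lp_approx_tendsto:
  assumes "summable (\<lambda>k. (\<alpha> (Suc k))\<^sup>2)"
  shows "(\<lambda>N. (deriv ^^ k) (\<lambda>z. exp (of_real b * z) * lp_approx a \<alpha> N z) 0)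
    \<longlonglongrightarrow> (deriv ^^ k) (LP_fun a b 1 0 \<alpha>) 0"
proof (rule higher_deriv_complex_uniform_limit)
  note bounded = compact_imp_bounded[OF compact_continuous_image[OF _ compact_cball]]
  have gauss: "continuous_on (cball 0 1) (\<lambda>z::complex. exp (of_real (- (a\<^sup>2)) * z\<^sup>2))"
    and "continuous_on (cball 0 1) (\<lambda>z::complex. exp (of_real b * z))"
    by (intro continuous_intros)+
  then have "uniform_limit (cball 0 1) (\<lambda>N z. exp (of_real b * z) * lp_approx a \<alpha> N z)
      (\<lambda>z. exp (of_real b * z) * (exp (of_real (- (a\<^sup>2)) * z\<^sup>2) *
        (\<Prod>k. (1 - of_real (\<alpha> (Suc k)) * z) * exp (of_real (\<alpha> (Suc k)) * z)))) sequentially"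
    unfolding lp_approx_def
    by (intro uniform_lim_mult uniform_limit_const uniform_limit_gaussian bounded continuous_on_mult
        uniform_limit_lp_product[OF assms] continuous_on_lp_product[OF assms])
  also have "(\<lambda>z. exp (of_real b * z) * (exp (of_real (- (a\<^sup>2)) * z\<^sup>2) *
        (\<Prod>k. (1 - of_real (\<alpha> (Suc k)) * z) * exp (of_real (\<alpha> (Suc k)) * z)))) = LP_fun a b 1 0 \<alpha>"
    unfolding LP_fun_def exp_add by (rule ext) simp
  finally show "uniform_limit (ball 0 1) (\<lambda>N z. exp (of_real b * z) * lp_approx a \<alpha> N z)
      (LP_fun a b 1 0 \<alpha>) sequentially"
    by (rule uniform_limit_on_subset) auto
  show "\<forall>\<^sub>F N in sequentially. (\<lambda>z. exp (of_real b * z) * lp_approx a \<alpha> N z) holomorphic_on ball 0 1"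
    unfolding lp_approx_def by (intro always_eventually allI holomorphic_intros) auto
qed auto

section \<open>Passage from the approximating operators to the deformations\<close>

definition diff_approx ::
  "real \<Rightarrow> real \<Rightarrow> (nat \<Rightarrow> real) \<Rightarrow> nat \<Rightarrow> complex poly \<Rightarrow> complex poly" where
  "diff_approx a b \<alpha> N P = diff_fps (lp_prod (lp_coeffs a \<alpha> N)) (diff_fps (fps_exp (of_real b)) P)"

text \<open>On a fixed polynomial only the Taylor coefficients up to its degree act, so convergence
  of each coefficient suffices.\<close>

lemma tendsto_poly_diff_approx:
  assumes "summable (\<lambda>k. (\<alpha> (Suc k))\<^sup>2)"
  shows "(\<lambda>N. poly (diff_approx a b \<alpha> N P) z) \<longlonglongrightarrow> poly (diff_op (LP_fun a b 1 0 \<alpha>) P) z"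
proof -
  let ?F = "\<lambda>N. fps_exp (of_real b) * lp_prod (lp_coeffs a \<alpha> N)"
  have "(\<lambda>z. exp (of_real b * z) * lp_approx a \<alpha> N z) has_fps_expansion ?F N" for N
    by (intro fps_expansion_intros has_fps_expansion_lp_approx)
  then have nth: "fps_nth (?F N) k =
      (deriv ^^ k) (\<lambda>z. exp (of_real b * z) * lp_approx a \<alpha> N z) 0 / fact k" for N k
    by (rule fps_nth_fps_expansion)
  have "diff_approx a b \<alpha> N P = diff_fps (?F N) P" for N
    by (simp add: diff_approx_def diff_fps_mult[symmetric] mult.commute)
  then show ?thesis
    by (auto simp: poly_diff_fps nth diff_op_def poly_sum
        intro!: tendsto_intros deriv_lp_approx_tendsto[OF assms])
qed

lemma hyperbolic_exp: "P \<in> hyperbolic n \<Longrightarrow> diff_fps (fps_exp (of_real b)) P \<in> hyperbolic n"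
  by (simp add: diff_fps_exp hyperbolic_shift)

lemma hyperbolic_diff_approx: "P \<in> hyperbolic n \<Longrightarrow> diff_approx a b \<alpha> N P \<in> hyperbolic n"
  by (simp add: diff_approx_def hyperbolic_lp_prod hyperbolic_exp)

lemma hyperbolic_diff_op_LP_fun:
  assumes "summable (\<lambda>k. (\<alpha> (Suc k))\<^sup>2)" "P \<in> hyperbolic n"
  shows "diff_op (LP_fun a b 1 0 \<alpha>) P \<in> hyperbolic n"
  by (rule hyperbolic_limit[OF hyperbolic_diff_approx[OF assms(2)] tendsto_poly_diff_approx[OF assms(1)]])

text \<open>With equal b both approximations start from the same shifted polynomial. Their
  coefficient lists compare entry by entry, because the order is kept by division by sqrt N and by
  negation of both sides.\<close>

lemma majorized_diff_op_LP_fun: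
  assumes \<alpha>: "summable (\<lambda>k. (\<alpha> (Suc k))\<^sup>2)" and \<alpha>': "summable (\<lambda>k. (\<alpha>' (Suc k))\<^sup>2)"
    and a: "\<bar>a\<bar> \<le> \<bar>a'\<bar>" "a * a' \<ge> 0" and le: "\<And>k. \<bar>\<alpha> k\<bar> \<le> \<bar>\<alpha>' k\<bar>" "\<And>k. \<alpha> k * \<alpha>' k \<ge> 0"
    and P: "P \<in> hyperbolic n"
  shows "majorized (real_zeros (diff_op (LP_fun a b 1 0 \<alpha>) P)) (real_zeros (diff_op (LP_fun a' b 1 0 \<alpha>') P))"
proof (rule majorized_limit[OF hyperbolic_diff_approx[OF P] tendsto_poly_diff_approx[OF \<alpha>]
      hyperbolic_diff_approx[OF P] tendsto_poly_diff_approx[OF \<alpha>']])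
  fix N
  have "list_all2 (\<lambda>\<alpha> \<beta>. \<bar>\<alpha>\<bar> \<le> \<bar>\<beta>\<bar> \<and> \<alpha> * \<beta> \<ge> 0) (lp_coeffs a \<alpha> N) (lp_coeffs a' \<alpha>' N)"
    unfolding lp_coeffs_def
  proof (intro list_all2_appendI)
    have "\<bar>a / sqrt N\<bar> \<le> \<bar>a' / sqrt N\<bar>" "a / sqrt N * (a' / sqrt N) \<ge> 0"
      using a by (simp_all add: abs_divide divide_right_mono)
    then show "list_all2 (\<lambda>\<alpha> \<beta>. \<bar>\<alpha>\<bar> \<le> \<bar>\<beta>\<bar> \<and> \<alpha> * \<beta> \<ge> 0) (replicate N (a / sqrt N)) (replicate N (a' / sqrt N))"
      and "list_all2 (\<lambda>\<alpha> \<beta>. \<bar>\<alpha>\<bar> \<le> \<bar>\<beta>\<bar> \<and> \<alpha> * \<beta> \<ge> 0) (replicate N (- (a / sqrt N))) (replicate N (- (a' / sqrt N)))"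
      by (simp_all add: list_all2_conv_all_nth)
  qed (use le in \<open>simp add: list_all2_conv_all_nth\<close>)
  then show "majorized (real_zeros (diff_approx a b \<alpha> N P)) (real_zeros (diff_approx a' b \<alpha>' N P))"
    unfolding diff_approx_def by (rule majorized_lp_prod) (rule hyperbolic_exp[OF P])
qed

lemma linear_diff_op: "Vector_Spaces.linear smult smult (diff_op \<phi>)"
proof -
  have "diff_op \<phi> = diff_fps (Abs_fps (\<lambda>k. (deriv ^^ k) \<phi> 0 / fact k))"
    by (rule ext) (simp add: diff_op_def diff_fps_def)
  then show ?thesis by (simp add: linear_diff_fps)
qed

text \<open>The constant polynomial 1 must be fixed, so the symbol has value 1 at 0; a positive m
  would force the value 0.\<close>

lemma preserver_imp_normalized:
  assumes "diff_op (LP_fun a b c m \<alpha>) \<in> preservers"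
  shows "c = 1" "m = 0"
proof -
  have "1 \<in> hyperbolic 0" by (simp add: hyperbolic_def)
  then have "diff_op (LP_fun a b c m \<alpha>) 1 \<in> hyperbolic 0"
    using assms by (auto simp: preservers_def)
  then have "LP_fun a b c m \<alpha> 0 = 1"
    by (simp add: diff_op_def hyperbolic_def)
  then show "c = 1" "m = 0"
    by (auto simp: LP_fun_def power_0_left split: if_splits)
qed

text \<open>Boundedness of the deforming sequence keeps the new parameters square summable, so the
  deformed symbol stays in the Laguerre-Polya class.\<close>

lemma summable_deformed:
  assumes "s \<in> l_infinity" "summable (\<lambda>k. (\<alpha> (Suc k))\<^sup>2)"
  shows "summable (\<lambda>k. (s (Suc k) * \<alpha> (Suc k))\<^sup>2)"
proof -
  obtain K where K: "\<And>k. \<bar>s k\<bar> \<le> K"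
    using assms(1) by (auto simp: l_infinity_def bounded_iff)
  show ?thesis
  proof (rule summable_comparison_test')
    show "summable (\<lambda>k. K\<^sup>2 * (\<alpha> (Suc k))\<^sup>2)"
      by (rule summable_mult[OF assms(2)])
    fix k
    have "(s (Suc k))\<^sup>2 \<le> K\<^sup>2"
      using K[of "Suc k"] by (rule power2_le_iff_abs_le[THEN iffD2, rotated]) (use K[of 0] in simp)
    then show "norm ((s (Suc k) * \<alpha> (Suc k))\<^sup>2) \<le> K\<^sup>2 * (\<alpha> (Suc k))\<^sup>2"
      by (simp add: power_mult_distrib mult_right_mono)
  qed
qed

theorem corollary6:
  fixes T :: "complex poly \<Rightarrow> complex poly"
    and a b c :: real and m :: nat and \<alpha> s t :: "nat \<Rightarrow> real"
  assumes "T \<in> preservers"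
    and "LP_params a b c m \<alpha>"
    and "T = diff_op (LP_fun a b c m \<alpha>)"
    and "s \<in> l_infinity" and "t \<in> l_infinity"
    and "seq_le s t"
  shows "preserver_le (diff_op (LP_deform s a b c m \<alpha>)) (diff_op (LP_deform t a b c m \<alpha>))"
proof -
  have cm: "c = 1" "m = 0"
    using assms(1) unfolding assms(3) by (rule preserver_imp_normalized)+
  have \<alpha>: "summable (\<lambda>k. (\<alpha> (Suc k))\<^sup>2)"
    using assms(2) by (simp add: LP_params_def)
  note sums = summable_deformed[OF assms(4) \<alpha>] summable_deformed[OF assms(5) \<alpha>]
  \<comment> \<open>A common real factor preserves the order of the sequences; r is a at index 0 and
    the zero parameter \<alpha> k otherwise.\<close>
  have mult_le: "\<bar>s k * r\<bar> \<le> \<bar>t k * r\<bar>" "s k * r * (t k * r) \<ge> 0" for k r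
  proof -
    show "\<bar>s k * r\<bar> \<le> \<bar>t k * r\<bar>"
      using assms(6) by (simp add: seq_le_def abs_mult mult_right_mono)
    have "s k * r * (t k * r) = s k * t k * r\<^sup>2" by (simp add: power2_eq_square)
    moreover have "s k * t k \<ge> 0" using assms(6) by (simp add: seq_le_def)
    ultimately show "s k * r * (t k * r) \<ge> 0" by (metis mult_nonneg_nonneg zero_le_power2)
  qed
  show ?thesis
    unfolding preserver_le_def preservers_def spectral_le_def LP_deform_def cm
    using hyperbolic_diff_op_LP_fun[where \<alpha> = "\<lambda>k. s k * \<alpha> k", OF sums(1)]
      hyperbolic_diff_op_LP_fun[where \<alpha> = "\<lambda>k. t k * \<alpha> k", OF sums(2)]
      majorized_diff_op_LP_fun[where \<alpha> = "\<lambda>k. s k * \<alpha> k" and \<alpha>' = "\<lambda>k. t k * \<alpha> k", OF sums mult_le mult_le]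
      linear_diff_op by blast
qed

end
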